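(* In the quantum torus $T_q$, the generating functions $w^-(t)=\sum_{i\ge 0}w_{-i}t^i$, $w^+(t)=\sum_{i\ge 0}w_{i+1}t^i$, $g(t)=\sum_{i\ge 0}g_it^i$, $\tilde g(t)=\sum_{i\ge 0}\tilde g_it^i$ of the alternating elements of $T_q$ are given, as formal power series in $T_q[[t]]$, by $$w^-(t)=\omega(t)\,(x+x^{-1}),$$ $$w^+(t)=\omega(t)\,(y+y^{-1}),$$ $$g(t)=(q^2-q^{-2})\,\omega(t)\,\bigl(t(qx^{-1}y+qxy^{-1})-q-q^{-1}\bigr),$$ $$\tilde g(t)=(q^2-q^{-2})\,\omega(t)\,\bigl(t(q^{-1}xy+q^{-1}x^{-1}y^{-1})-q-q^{-1}\bigr),$$ where $\omega(t)=\sum_{i=0}^{\infty}\binom{2i}{i}\left(\frac{t}{q+q^{-1}}\right)^{2i}$.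
   Context: $K$ is a field of characteristic $0$; $q\in K$ is nonzero with $q^4\neq 1$. Algebras are associative, unital, over $K$. $\mathbb N=\{0,1,2,\dots\}$. $[u,v]=uv-vu$ and $[u,v]_r=ruv-r^{-1}vu$ for nonzero $r\in K$. The $q$-Onsager algebra $O_q$ has generators $W_0,W_1$ and relations $[W_0,[W_0,[W_0,W_1]_q]_{q^{-1}}]=-(q^2-q^{-2})^2[W_0,W_1]$ and $[W_1,[W_1,[W_1,W_0]_q]_{q^{-1}}]=-(q^2-q^{-2})^2[W_1,W_0]$. Its alternating central extension $\mathcal O_q$ has generators $\mathcal W_{-k},\mathcal W_{k+1},\mathcal G_{k+1},\tilde{\mathcal G}_{k+1}$ ($k\in\mathbb N$) and, with $\rho=-(q^2-q^{-2})^2$, the relations, for all $k,\ell\in\mathbb N$: $[\mathcal W_0,\mathcal W_{k+1}]=[\mathcal W_{-k},\mathcal W_1]=(\tilde{\mathcal G}_{k+1}-\mathcal G_{k+1})/(q+q^{-1})$; $[\mathcal W_0,\mathcal G_{k+1}]_q=[\tilde{\mathcal G}_{k+1},\mathcal W_0]_q=\rho\mathcal W_{-k-1}-\rho\mathcal W_{k+1}$; $[\mathcal G_{k+1},\mathcal W_1]_q=[\mathcal W_1,\tilde{\mathcal G}_{k+1}]_q=\rho\mathcal W_{k+2}-\rho\mathcal W_{-k}$; $[\mathcal W_{-k},\mathcal W_{-\ell}]=0$; $[\mathcal W_{k+1},\mathcal W_{\ell+1}]=0$; $[\mathcal W_{-k},\mathcal W_{\ell+1}]+[\mathcal W_{k+1},\mathcal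 W_{-\ell}]=0$; $[\mathcal W_{-k},\mathcal G_{\ell+1}]+[\mathcal G_{k+1},\mathcal W_{-\ell}]=0$; $[\mathcal W_{-k},\tilde{\mathcal G}_{\ell+1}]+[\tilde{\mathcal G}_{k+1},\mathcal W_{-\ell}]=0$; $[\mathcal W_{k+1},\mathcal G_{\ell+1}]+[\mathcal G_{k+1},\mathcal W_{\ell+1}]=0$; $[\mathcal W_{k+1},\tilde{\mathcal G}_{\ell+1}]+[\tilde{\mathcal G}_{k+1},\mathcal W_{\ell+1}]=0$; $[\mathcal G_{k+1},\mathcal G_{\ell+1}]=0$; $[\tilde{\mathcal G}_{k+1},\tilde{\mathcal G}_{\ell+1}]=0$; $[\tilde{\mathcal G}_{k+1},\mathcal G_{\ell+1}]+[\mathcal G_{k+1},\tilde{\mathcal G}_{\ell+1}]=0$. Put $\mathcal G_0=\tilde{\mathcal G}_0=-(q-q^{-1})(q+q^{-1})^2$. Let $\mathcal W^-(t)=\sum_{i\ge0}\mathcal W_{-i}t^i$, $\mathcal W^+(t)=\sum_{i\ge0}\mathcal W_{i+1}t^i$, $\mathcal G(t)=\sum_{i\ge0}\mathcal G_it^i$, $\tilde{\mathcal G}(t)=\sum_{i\ge0}\tilde{\mathcal G}_it^i$. Let $T=\frac{q+q^{-1}}{qt+q^{-1}t^{-1}}=(q+q^{-1})\sum_{\ell\ge0}(-1)^\ell q^{2\ell+1}t^{2\ell+1}$ and $S=\frac{q+q^{-1}}{qt^{-1}+q^{-1}t}=(q+q^{-1})\sum_{\ell\ge0}(-1)^\ell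 q^{-(2\ell+1)}t^{2\ell+1}$ (power series in $t$ without constant term, so $t^{-1}ST$ is a power series). Elements $\mathcal Z_i\in\mathcal O_q$ ($i\ge0$) are given by $$\sum_{i\ge0}\mathcal Z_i(q+q^{-1})^it^i=t^{-1}ST\,\mathcal W^-(S)\mathcal W^+(T)+tST\,\mathcal W^+(S)\mathcal W^-(T)-q^2ST\,\mathcal W^-(S)\mathcal W^-(T)-q^{-2}ST\,\mathcal W^+(S)\mathcal W^+(T)+(q^2-q^{-2})^{-2}\mathcal G(S)\tilde{\mathcal G}(T);$$ one has $\mathcal Z_0=(q+q^{-1})^2$. Part of the standing setup is the previously known fact that the $\mathcal Z_i$ are central and that there is an algebra isomorphism $\phi:O_q\otimes K[z_1,z_2,\dots]\to\mathcal O_q$ with $W_0\otimes1\mapsto\mathcal W_0$, $W_1\otimes1\mapsto\mathcal W_1$, $1\otimes z_i\mapsto\mathcal Z_i$ ($i\ge1$), where the $z_i$ are commuting indeterminates. The homomorphism $\gamma:\mathcal O_q\to O_q$ is $\phi^{-1}$ followed by setting all $z_i=0$; so $\gamma(\mathcal W_0)=W_0$, $\gamma(\mathcal W_1)=W_1$, $\gamma(\mathcal Z_i)=0$ for $i\ge1$. The alternating elements of $O_q$ are $W_{-k}=\gamma(\mathcal W_{-k})$, $W_{k+1}=\gamma(\mathcal W_{k+1})$, $G_{k+1}=\gamma(\mathcal G_{k+1})$, $\tilde G_{k+1}=\gamma(\tilde{\mathcal G}_{k+1})$, $k\in\mathbb N$. The quantum torus $T_q$ is the algebra with generators $x,y,x^{-1},y^{-1}$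 and relations $xx^{-1}=1=x^{-1}x$, $yy^{-1}=1=y^{-1}y$, $xy=q^2yx$; it has basis $\{x^ay^b: a,b\in\mathbb Z\}$. There is an algebra homomorphism $p:O_q\to T_q$ with $W_0\mapsto x+x^{-1}$, $W_1\mapsto y+y^{-1}$. The alternating elements of $T_q$ are $w_{-k}=p(W_{-k})$, $w_{k+1}=p(W_{k+1})$, $g_{k+1}=p(G_{k+1})$, $\tilde g_{k+1}=p(\tilde G_{k+1})$ for $k\in\mathbb N$, and by convention $g_0=\tilde g_0=-(q-q^{-1})(q+q^{-1})^2$. *)

theory Defs
  imports
    "HOL-Algebra.QuotRing"
    "HOL-Algebra.Module"
    "HOL-Library.Multiset"
    "HOL-Computational_Algebra.Formal_Power_Series"
begin

text \<open>
  The ground field is a type \<open>'k\<close> of class \<open>field\<close>. A (possibly noncommutative) \<open>'k\<close>-algebra is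
  given by a record of type \<open>('k, 'a) module\<close>, that is, a ring record together with a scalar
  multiplication. The library locale \<open>algebra\<close> is not used because it requires commutativity.
\<close>

section \<open>Algebras over a field\<close>

definition alg_hom :: "('k, 'a) module \<Rightarrow> ('k, 'b) module \<Rightarrow> ('a \<Rightarrow> 'b) set" where
  "alg_hom A B = {h \<in> ring_hom A B. \<forall>c. \<forall>a \<in> carrier A. h (c \<odot>\<^bsub>A\<^esub> a) = c \<odot>\<^bsub>B\<^esub> h a}"

definition alg_iso :: "('k, 'a) module \<Rightarrow> ('k, 'b) module \<Rightarrow> ('a \<Rightarrow> 'b) set" where
  "alg_iso A B = {h \<in> alg_hom A B. bij_betw h (carrier A) (carrier B)}"

definition quot_algebra :: "('k, 'a) module \<Rightarrow> 'a set \<Rightarrow> ('k, 'a set) module" where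
  "quot_algebra A I =
    \<lparr>carrier = carrier (A Quot I), monoid.mult = monoid.mult (A Quot I), one = one (A Quot I),
     zero = zero (A Quot I), add = add (A Quot I),
     smult = (\<lambda>c X. \<Union>x\<in>X. I +>\<^bsub>A\<^esub> (c \<odot>\<^bsub>A\<^esub> x))\<rparr>"

definition quot_by_relations :: "('k, 'a) module \<Rightarrow> ('a \<times> 'a) set \<Rightarrow> ('k, 'a set) module" where
  "quot_by_relations A R = quot_algebra A (Idl\<^bsub>A\<^esub> {l \<ominus>\<^bsub>A\<^esub> r | l r. (l, r) \<in> R})"

definition rel_class :: "('k, 'a) module \<Rightarrow> ('a \<times> 'a) set \<Rightarrow> 'a \<Rightarrow> 'a set" where
  "rel_class A R a = (Idl\<^bsub>A\<^esub> {l \<ominus>\<^bsub>A\<^esub> r | l r. (l, r) \<in> R}) +>\<^bsub>A\<^esub> a"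

text \<open>
  The monoid algebra: finitely supported functions on the monoid, with convolution as product.
  Free algebras, polynomial algebras and tensor products are all obtained from it.
\<close>

definition monoid_algebra :: "('m, 'c) monoid_scheme \<Rightarrow> ('k::field, 'm \<Rightarrow> 'k) module" where
  "monoid_algebra M =
    \<lparr>carrier = {f. finite {m. f m \<noteq> 0} \<and> {m. f m \<noteq> 0} \<subseteq> carrier M},
     monoid.mult = (\<lambda>f g m. \<Sum>(u, v) \<in> {u. f u \<noteq> 0} \<times> {v. g v \<noteq> 0}.
                       if u \<otimes>\<^bsub>M\<^esub> v = m then f u * g v else 0),
     one = (\<lambda>m. if m = \<one>\<^bsub>M\<^esub> then 1 else 0),
     zero = (\<lambda>_. 0),
     add = (\<lambda>f g m. f m + g m),
     smult = (\<lambda>c f m. c * f m)\<rparr>"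

definition basis_elem :: "'m \<Rightarrow> 'm \<Rightarrow> 'k::field" where
  "basis_elem m = (\<lambda>n. if n = m then 1 else 0)"

definition free_algebra :: "('k::field, 'g list \<Rightarrow> 'k) module" where
  "free_algebra = monoid_algebra \<lparr>carrier = UNIV, monoid.mult = (@), one = []\<rparr>"

definition free_gen :: "'g \<Rightarrow> 'g list \<Rightarrow> 'k::field" where
  "free_gen g = basis_elem [g]"

definition presented_algebra ::
    "(('g list \<Rightarrow> 'k) \<times> ('g list \<Rightarrow> 'k)) set \<Rightarrow> ('k::field, ('g list \<Rightarrow> 'k) set) module" where
  "presented_algebra R = quot_by_relations free_algebra R"

definition presented_gen ::
    "(('g list \<Rightarrow> 'k) \<times> ('g list \<Rightarrow> 'k)) set \<Rightarrow> 'g \<Rightarrow> ('g list \<Rightarrow> 'k::field) set" where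
  "presented_gen R g = rel_class free_algebra R (free_gen g)"

text \<open>Monomials in commuting indeterminates indexed by \<open>V\<close> are finite multisets over \<open>V\<close>.\<close>

definition poly_algebra :: "'v set \<Rightarrow> ('k::field, 'v multiset \<Rightarrow> 'k) module" where
  "poly_algebra V = monoid_algebra \<lparr>carrier = {m. set_mset m \<subseteq> V}, monoid.mult = (+), one = {#}\<rparr>"

definition poly_var :: "'v \<Rightarrow> 'v multiset \<Rightarrow> 'k::field" where
  "poly_var v = basis_elem {#v#}"

text \<open>
  The tensor product \<open>A \<otimes> B\<close> is the free vector space on \<open>A \<times> B\<close> modulo bilinearity, with
  \<open>(a \<otimes> b) (a' \<otimes> b') = a a' \<otimes> b b'\<close>; the free vector space with this product is the monoid
  algebra of the multiplicative monoid of \<open>A \<times> B\<close>, in which the span of the bilinearity relations is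
  already a two-sided ideal.
\<close>

definition bilinear_relations ::
    "('k, 'a) module \<Rightarrow> ('k, 'b) module \<Rightarrow> (('a \<times> 'b \<Rightarrow> 'k::field) \<times> ('a \<times> 'b \<Rightarrow> 'k)) set" where
  "bilinear_relations A B =
     (let M = monoid_algebra (A \<times>\<times> B) in
       {(basis_elem (a \<oplus>\<^bsub>A\<^esub> a', b), basis_elem (a, b) \<oplus>\<^bsub>M\<^esub> basis_elem (a', b)) | a a' b.
          a \<in> carrier A \<and> a' \<in> carrier A \<and> b \<in> carrier B}
     \<union> {(basis_elem (a, b \<oplus>\<^bsub>B\<^esub> b'), basis_elem (a, b) \<oplus>\<^bsub>M\<^esub> basis_elem (a, b')) | a b b'.
          a \<in> carrier A \<and> b \<in> carrier B \<and> b' \<in> carrier B}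
     \<union> {(basis_elem (c \<odot>\<^bsub>A\<^esub> a, b), c \<odot>\<^bsub>M\<^esub> basis_elem (a, b)) | c a b.
          a \<in> carrier A \<and> b \<in> carrier B}
     \<union> {(basis_elem (a, c \<odot>\<^bsub>B\<^esub> b), c \<odot>\<^bsub>M\<^esub> basis_elem (a, b)) | c a b.
          a \<in> carrier A \<and> b \<in> carrier B})"

definition tensor_algebra ::
    "('k, 'a) module \<Rightarrow> ('k, 'b) module \<Rightarrow> ('k::field, ('a \<times> 'b \<Rightarrow> 'k) set) module" where
  "tensor_algebra A B = quot_by_relations (monoid_algebra (A \<times>\<times> B)) (bilinear_relations A B)"

definition pure_tensor ::
    "('k, 'a) module \<Rightarrow> ('k, 'b) module \<Rightarrow> 'a \<Rightarrow> 'b \<Rightarrow> ('a \<times> 'b \<Rightarrow> 'k::field) set" where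
  "pure_tensor A B a b =
     rel_class (monoid_algebra (A \<times>\<times> B)) (bilinear_relations A B) (basis_elem (a, b))"

text \<open>
  The map \<open>A \<otimes> K[z\<^sub>v | v \<in> V] \<rightarrow> A\<close> setting all indeterminates to zero, that is,
  \<open>a \<otimes> f \<mapsto> f(0) a\<close>, where \<open>f(0)\<close> is the coefficient of the empty monomial. It is computed on an
  arbitrary representative \<open>F\<close> of the class \<open>X\<close>.
\<close>

definition set_vars_zero ::
    "('k, 'a) module \<Rightarrow> ('a \<times> ('v multiset \<Rightarrow> 'k::field) \<Rightarrow> 'k) set \<Rightarrow> 'a" where
  "set_vars_zero A X =
     the_elem ((\<lambda>F. \<Oplus>\<^bsub>A\<^esub>u\<in>{u. F u \<noteq> 0}. (F u * snd u {#}) \<odot>\<^bsub>A\<^esub> fst u) ` X)"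

definition commutator :: "('k, 'a) module \<Rightarrow> 'a \<Rightarrow> 'a \<Rightarrow> 'a" where
  "commutator A u v = u \<otimes>\<^bsub>A\<^esub> v \<ominus>\<^bsub>A\<^esub> v \<otimes>\<^bsub>A\<^esub> u"

definition q_commutator :: "('k::field, 'a) module \<Rightarrow> 'k \<Rightarrow> 'a \<Rightarrow> 'a \<Rightarrow> 'a" where
  "q_commutator A r u v = r \<odot>\<^bsub>A\<^esub> (u \<otimes>\<^bsub>A\<^esub> v) \<ominus>\<^bsub>A\<^esub> inverse r \<odot>\<^bsub>A\<^esub> (v \<otimes>\<^bsub>A\<^esub> u)"


section \<open>Formal power series with coefficients in an algebra\<close>

text \<open>\<open>A[[t]]\<close> as an algebra over \<open>K[[t]]\<close>, where \<open>t\<close> is central.\<close>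

definition series_algebra :: "('k::field, 'a) module \<Rightarrow> ('k fps, nat \<Rightarrow> 'a) module" where
  "series_algebra A =
    \<lparr>carrier = UNIV \<rightarrow> carrier A,
     monoid.mult = (\<lambda>f g n. \<Oplus>\<^bsub>A\<^esub>i\<in>{..n}. f i \<otimes>\<^bsub>A\<^esub> g (n - i)),
     one = (\<lambda>n. if n = 0 then \<one>\<^bsub>A\<^esub> else \<zero>\<^bsub>A\<^esub>),
     zero = (\<lambda>_. \<zero>\<^bsub>A\<^esub>),
     add = (\<lambda>f g n. f n \<oplus>\<^bsub>A\<^esub> g n),
     smult = (\<lambda>c f n. \<Oplus>\<^bsub>A\<^esub>i\<in>{..n}. fps_nth c i \<odot>\<^bsub>A\<^esub> f (n - i))\<rparr>"

definition series_const :: "('k, 'a) module \<Rightarrow> 'a \<Rightarrow> nat \<Rightarrow> 'a" where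
  "series_const A a = (\<lambda>n. if n = 0 then a else \<zero>\<^bsub>A\<^esub>)"

text \<open>
  The composite \<open>f(s) = \<Sum>i. f\<^sub>i s\<^sup>i\<close> for a scalar series \<open>s\<close> without constant term; then only the
  terms with \<open>i \<le> n\<close> contribute to the coefficient of \<open>t\<^sup>n\<close>.
\<close>

definition series_subst ::
    "('k::field, 'a) module \<Rightarrow> (nat \<Rightarrow> 'a) \<Rightarrow> 'k fps \<Rightarrow> nat \<Rightarrow> 'a" where
  "series_subst A f s = (\<lambda>n. \<Oplus>\<^bsub>A\<^esub>i\<in>{..n}. fps_nth (s ^ i) n \<odot>\<^bsub>A\<^esub> f i)"


section \<open>The \<open>q\<close>-Onsager algebra\<close>

datatype onsager_gen = Ons0 | Ons1

definition rho :: "'k::field \<Rightarrow> 'k" where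
  "rho q = - (q\<^sup>2 - inverse q ^ 2)\<^sup>2"

definition onsager_relations ::
    "'k::field \<Rightarrow> ((onsager_gen list \<Rightarrow> 'k) \<times> (onsager_gen list \<Rightarrow> 'k)) set" where
  "onsager_relations q =
     (let F = free_algebra; W0 = free_gen Ons0; W1 = free_gen Ons1 in
       {(commutator F W0 (q_commutator F (inverse q) W0 (q_commutator F q W0 W1)),
         rho q \<odot>\<^bsub>F\<^esub> commutator F W0 W1),
        (commutator F W1 (q_commutator F (inverse q) W1 (q_commutator F q W1 W0)),
         rho q \<odot>\<^bsub>F\<^esub> commutator F W1 W0)})"

definition q_Onsager :: "'k::field \<Rightarrow> ('k, (onsager_gen list \<Rightarrow> 'k) set) module" where
  "q_Onsager q = presented_algebra (onsager_relations q)"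

definition onsager_elem :: "'k::field \<Rightarrow> onsager_gen \<Rightarrow> (onsager_gen list \<Rightarrow> 'k) set" where
  "onsager_elem q = presented_gen (onsager_relations q)"


section \<open>The alternating central extension of the \<open>q\<close>-Onsager algebra\<close>

text \<open>
  \<open>Wneg k\<close>, \<open>Wpos k\<close>, \<open>Gpl k\<close>, \<open>Gtl k\<close> stand for the generators \<open>W\<^bsub>-k\<^esub>\<close>, \<open>W\<^bsub>k+1\<^esub>\<close>, \<open>G\<^bsub>k+1\<^esub>\<close> and
  \<open>G\<^bsub>k+1\<^esub>\<close> with a tilde.
\<close>

datatype ace_gen = Wneg nat | Wpos nat | Gpl nat | Gtl nat

definition ace_relations ::
    "'k::field \<Rightarrow> ((ace_gen list \<Rightarrow> 'k) \<times> (ace_gen list \<Rightarrow> 'k)) set" where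
  "ace_relations q =
     (let F = free_algebra; br = commutator F; qbr = q_commutator F q;
          Wm = (\<lambda>k. free_gen (Wneg k)); Wp = (\<lambda>k. free_gen (Wpos k));
          G = (\<lambda>k. free_gen (Gpl k)); Gt = (\<lambda>k. free_gen (Gtl k)) in
       (\<Union>k. {(br (Wm 0) (Wp k), inverse (q + inverse q) \<odot>\<^bsub>F\<^esub> (Gt k \<ominus>\<^bsub>F\<^esub> G k)),
              (br (Wm k) (Wp 0), inverse (q + inverse q) \<odot>\<^bsub>F\<^esub> (Gt k \<ominus>\<^bsub>F\<^esub> G k)),
              (qbr (Wm 0) (G k), (rho q \<odot>\<^bsub>F\<^esub> Wm (k + 1)) \<ominus>\<^bsub>F\<^esub> (rho q \<odot>\<^bsub>F\<^esub> Wp k)),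
              (qbr (Gt k) (Wm 0), (rho q \<odot>\<^bsub>F\<^esub> Wm (k + 1)) \<ominus>\<^bsub>F\<^esub> (rho q \<odot>\<^bsub>F\<^esub> Wp k)),
              (qbr (G k) (Wp 0), (rho q \<odot>\<^bsub>F\<^esub> Wp (k + 1)) \<ominus>\<^bsub>F\<^esub> (rho q \<odot>\<^bsub>F\<^esub> Wm k)),
              (qbr (Wp 0) (Gt k), (rho q \<odot>\<^bsub>F\<^esub> Wp (k + 1)) \<ominus>\<^bsub>F\<^esub> (rho q \<odot>\<^bsub>F\<^esub> Wm k))}) \<union>
       (\<Union>k l. {(br (Wm k) (Wm l), \<zero>\<^bsub>F\<^esub>),
                (br (Wp k) (Wp l), \<zero>\<^bsub>F\<^esub>),
                (br (Wm k) (Wp l) \<oplus>\<^bsub>F\<^esub> br (Wp k) (Wm l), \<zero>\<^bsub>F\<^esub>),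
                (br (Wm k) (G l) \<oplus>\<^bsub>F\<^esub> br (G k) (Wm l), \<zero>\<^bsub>F\<^esub>),
                (br (Wm k) (Gt l) \<oplus>\<^bsub>F\<^esub> br (Gt k) (Wm l), \<zero>\<^bsub>F\<^esub>),
                (br (Wp k) (G l) \<oplus>\<^bsub>F\<^esub> br (G k) (Wp l), \<zero>\<^bsub>F\<^esub>),
                (br (Wp k) (Gt l) \<oplus>\<^bsub>F\<^esub> br (Gt k) (Wp l), \<zero>\<^bsub>F\<^esub>),
                (br (G k) (G l), \<zero>\<^bsub>F\<^esub>),
                (br (Gt k) (Gt l), \<zero>\<^bsub>F\<^esub>),
                (br (Gt k) (G l) \<oplus>\<^bsub>F\<^esub> br (G k) (Gt l), \<zero>\<^bsub>F\<^esub>)}))"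

definition alt_central_ext :: "'k::field \<Rightarrow> ('k, (ace_gen list \<Rightarrow> 'k) set) module" where
  "alt_central_ext q = presented_algebra (ace_relations q)"

definition ace_elem :: "'k::field \<Rightarrow> ace_gen \<Rightarrow> (ace_gen list \<Rightarrow> 'k) set" where
  "ace_elem q = presented_gen (ace_relations q)"

definition G_zero :: "'k::field \<Rightarrow> 'k" where
  "G_zero q = - (q - inverse q) * (q + inverse q)\<^sup>2"

text \<open>The series \<open>G\<^sub>0 + g 0 t + g 1 t\<^sup>2 + ...\<close>, with the scalar \<open>G\<^sub>0\<close> regarded as an element of \<open>A\<close>.\<close>

definition G_series :: "'k::field \<Rightarrow> ('k, 'a) module \<Rightarrow> (nat \<Rightarrow> 'a) \<Rightarrow> nat \<Rightarrow> 'a" where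
  "G_series q A g = (\<lambda>i. case i of 0 \<Rightarrow> G_zero q \<odot>\<^bsub>A\<^esub> \<one>\<^bsub>A\<^esub> | Suc k \<Rightarrow> g k)"

text \<open>
  \<open>T_ser q\<close> is the expansion of \<open>(q + q\<^sup>-\<^sup>1) / (q t + q\<^sup>-\<^sup>1 t\<^sup>-\<^sup>1)\<close>; exchanging \<open>q\<close> and \<open>q\<^sup>-\<^sup>1\<close> gives
  the series \<open>S\<close>.
\<close>

definition T_ser :: "'k::field \<Rightarrow> 'k fps" where
  "T_ser q = Abs_fps (\<lambda>n. if odd n then (q + inverse q) * (- 1) ^ (n div 2) * q ^ n else 0)"

definition S_ser :: "'k::field \<Rightarrow> 'k fps" where
  "S_ser q = T_ser (inverse q)"

definition Z_series :: "'k::field \<Rightarrow> nat \<Rightarrow> (ace_gen list \<Rightarrow> 'k) set" where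
  "Z_series q =
     (let A = alt_central_ext q; P = series_algebra A; S = S_ser q; T = T_ser q;
          Wm = (\<lambda>i. ace_elem q (Wneg i)); Wp = (\<lambda>i. ace_elem q (Wpos i));
          G = G_series q A (\<lambda>k. ace_elem q (Gpl k));
          Gt = G_series q A (\<lambda>k. ace_elem q (Gtl k)) in
       ((fps_shift 1 (S * T) \<odot>\<^bsub>P\<^esub> (series_subst A Wm S \<otimes>\<^bsub>P\<^esub> series_subst A Wp T))
        \<oplus>\<^bsub>P\<^esub> ((fps_X * S * T) \<odot>\<^bsub>P\<^esub> (series_subst A Wp S \<otimes>\<^bsub>P\<^esub> series_subst A Wm T))
        \<ominus>\<^bsub>P\<^esub> ((fps_const (q\<^sup>2) * S * T) \<odot>\<^bsub>P\<^esub> (series_subst A Wm S \<otimes>\<^bsub>P\<^esub> series_subst A Wm T))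
        \<ominus>\<^bsub>P\<^esub> ((fps_const (inverse q ^ 2) * S * T)
             \<odot>\<^bsub>P\<^esub> (series_subst A Wp S \<otimes>\<^bsub>P\<^esub> series_subst A Wp T)))
        \<oplus>\<^bsub>P\<^esub> (fps_const (inverse ((q\<^sup>2 - inverse q ^ 2)\<^sup>2))
             \<odot>\<^bsub>P\<^esub> (series_subst A G S \<otimes>\<^bsub>P\<^esub> series_subst A Gt T)))"

text \<open>The elements \<open>Z\<^sub>i\<close> are defined by \<open>\<Sum>i. Z\<^sub>i (q + q\<^sup>-\<^sup>1)\<^sup>i t\<^sup>i = Z_series q\<close>.\<close>

definition Z_elem :: "'k::field \<Rightarrow> nat \<Rightarrow> (ace_gen list \<Rightarrow> 'k) set" where
  "Z_elem q i = inverse ((q + inverse q) ^ i) \<odot>\<^bsub>alt_central_ext q\<^esub> Z_series q i"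

definition z_poly :: "('k::field, nat multiset \<Rightarrow> 'k) module" where
  "z_poly = poly_algebra {1..}"

definition onsager_tensor_poly ::
    "'k::field \<Rightarrow>
       ('k, ((onsager_gen list \<Rightarrow> 'k) set \<times> (nat multiset \<Rightarrow> 'k) \<Rightarrow> 'k) set) module" where
  "onsager_tensor_poly q = tensor_algebra (q_Onsager q) z_poly"

definition is_tensor_iso ::
    "'k::field \<Rightarrow>
       (((onsager_gen list \<Rightarrow> 'k) set \<times> (nat multiset \<Rightarrow> 'k) \<Rightarrow> 'k) set
         \<Rightarrow> (ace_gen list \<Rightarrow> 'k) set) \<Rightarrow> bool" where
  "is_tensor_iso q \<phi> \<longleftrightarrow>
     \<phi> \<in> alg_iso (onsager_tensor_poly q) (alt_central_ext q) \<and>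
     \<phi> (pure_tensor (q_Onsager q) z_poly (onsager_elem q Ons0) \<one>\<^bsub>z_poly\<^esub>) = ace_elem q (Wneg 0) \<and>
     \<phi> (pure_tensor (q_Onsager q) z_poly (onsager_elem q Ons1) \<one>\<^bsub>z_poly\<^esub>) = ace_elem q (Wpos 0) \<and>
     (\<forall>i\<ge>1. \<phi> (pure_tensor (q_Onsager q) z_poly \<one>\<^bsub>q_Onsager q\<^esub> (poly_var i)) = Z_elem q i)"

definition gamma ::
    "'k::field \<Rightarrow>
       (((onsager_gen list \<Rightarrow> 'k) set \<times> (nat multiset \<Rightarrow> 'k) \<Rightarrow> 'k) set
         \<Rightarrow> (ace_gen list \<Rightarrow> 'k) set)
       \<Rightarrow> (ace_gen list \<Rightarrow> 'k) set \<Rightarrow> (onsager_gen list \<Rightarrow> 'k) set" where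
  "gamma q \<phi> = set_vars_zero (q_Onsager q) \<circ> inv_into (carrier (onsager_tensor_poly q)) \<phi>"


section \<open>The quantum torus\<close>

datatype torus_gen = TX | TY | TXinv | TYinv

definition torus_relations ::
    "'k::field \<Rightarrow> ((torus_gen list \<Rightarrow> 'k) \<times> (torus_gen list \<Rightarrow> 'k)) set" where
  "torus_relations q =
     (let F = free_algebra; x = free_gen TX; y = free_gen TY;
          x' = free_gen TXinv; y' = free_gen TYinv in
       {(x \<otimes>\<^bsub>F\<^esub> x', \<one>\<^bsub>F\<^esub>), (x' \<otimes>\<^bsub>F\<^esub> x, \<one>\<^bsub>F\<^esub>),
        (y \<otimes>\<^bsub>F\<^esub> y', \<one>\<^bsub>F\<^esub>), (y' \<otimes>\<^bsub>F\<^esub> y, \<one>\<^bsub>F\<^esub>),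
        (x \<otimes>\<^bsub>F\<^esub> y, q\<^sup>2 \<odot>\<^bsub>F\<^esub> (y \<otimes>\<^bsub>F\<^esub> x))})"

definition quantum_torus :: "'k::field \<Rightarrow> ('k, (torus_gen list \<Rightarrow> 'k) set) module" where
  "quantum_torus q = presented_algebra (torus_relations q)"

definition torus_elem :: "'k::field \<Rightarrow> torus_gen \<Rightarrow> (torus_gen list \<Rightarrow> 'k) set" where
  "torus_elem q = presented_gen (torus_relations q)"

definition is_torus_projection ::
    "'k::field \<Rightarrow> ((onsager_gen list \<Rightarrow> 'k) set \<Rightarrow> (torus_gen list \<Rightarrow> 'k) set) \<Rightarrow> bool" where
  "is_torus_projection q p \<longleftrightarrow>
     p \<in> alg_hom (q_Onsager q) (quantum_torus q) \<and>
     p (onsager_elem q Ons0) = torus_elem q TX \<oplus>\<^bsub>quantum_torus q\<^esub> torus_elem q TXinv \<and>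
     p (onsager_elem q Ons1) = torus_elem q TY \<oplus>\<^bsub>quantum_torus q\<^esub> torus_elem q TYinv"

definition omega :: "'k::field \<Rightarrow> 'k fps" where
  "omega q = Abs_fps (\<lambda>n. if even n then of_nat (n choose (n div 2)) * inverse (q + inverse q) ^ n
                          else 0)"

end

theory Submission
  imports Defs
begin

text \<open>
  The composite \<open>p \<circ> \<gamma> \<circ> \<phi>\<close> is determined by its values on \<open>W\<^sub>0 \<otimes> 1\<close>, \<open>W\<^sub>1 \<otimes> 1\<close> and \<open>1 \<otimes> z\<^sub>i\<close>, so
  it suffices to exhibit one homomorphism \<open>\<theta>\<close> from the alternating central extension to the quantum
  torus that is given on generators by the claimed formulas, sends \<open>W\<^sub>0\<close>, \<open>W\<^sub>1\<close> to \<open>X = x + x\<^sup>-\<^sup>1\<close>,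
  \<open>Y = y + y\<^sup>-\<^sup>1\<close>, and kills all \<open>Z\<^sub>i\<close> with \<open>i \<ge> 1\<close>. (Solving the defining relations recursively for the
  alternating elements would require \<open>q\<^sup>2\<^sup>n \<noteq> -1\<close>.) With \<open>E = q x\<^sup>-\<^sup>1 y + q x y\<^sup>-\<^sup>1\<close> and
  \<open>F = q\<^sup>-\<^sup>1 x y + q\<^sup>-\<^sup>1 x\<^sup>-\<^sup>1 y\<^sup>-\<^sup>1\<close>, the relations reduce to \<open>X Y = q F + q\<^sup>-\<^sup>1 E\<close>, \<open>Y X = q E + q\<^sup>-\<^sup>1 F\<close> and
  four \<open>q\<close>-commutator identities between \<open>X, Y, E, F\<close>. Using also
  \<open>E F = q\<^sup>2 X\<^sup>2 + q\<^sup>-\<^sup>2 Y\<^sup>2 - 2 (q\<^sup>2 + q\<^sup>-\<^sup>2)\<close>, the series of the \<open>Z\<^sub>i\<close> is mapped to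
  \<open>\<omega>(S) \<omega>(T) (c\<^sup>2 - 2 (q\<^sup>2 + q\<^sup>-\<^sup>2) S T)\<close> with \<open>c = q + q\<^sup>-\<^sup>1\<close>. This is the constant \<open>c\<^sup>2\<close>: both have the same
  square because \<open>\<omega>(t)\<^sup>2 (c\<^sup>2 - 4 t\<^sup>2) = c\<^sup>2\<close>, and the same constant term.
\<close>

section \<open>Algebras and their homomorphisms\<close>

text \<open>Scalars range over a whole field type, so they carry no membership conditions. The last
  two axioms let them move past products, which is what makes them central in a noncommutative
  algebra.\<close>

locale nc_algebra = ring A for A :: "('k::field, 'a) module" (structure) +
  assumes smult_closed [simp, intro]: "a \<in> carrier A \<Longrightarrow> c \<odot> a \<in> carrier A"
    and smult_l_distr: "a \<in> carrier A \<Longrightarrow> (c + d) \<odot> a = c \<odot> a \<oplus> d \<odot> a"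
    and smult_r_distr: "a \<in> carrier A \<Longrightarrow> b \<in> carrier A \<Longrightarrow> c \<odot> (a \<oplus> b) = c \<odot> a \<oplus> c \<odot> b"
    and smult_smult: "a \<in> carrier A \<Longrightarrow> c \<odot> (d \<odot> a) = (c * d) \<odot> a"
    and smult_1 [simp]: "a \<in> carrier A \<Longrightarrow> 1 \<odot> a = a"
    and smult_mult_l: "a \<in> carrier A \<Longrightarrow> b \<in> carrier A \<Longrightarrow> (c \<odot> a) \<otimes> b = c \<odot> (a \<otimes> b)"
    and smult_mult_r: "a \<in> carrier A \<Longrightarrow> b \<in> carrier A \<Longrightarrow> a \<otimes> (c \<odot> b) = c \<odot> (a \<otimes> b)"
begin

lemma smult_0 [simp]: "a \<in> carrier A \<Longrightarrow> 0 \<odot> a = \<zero>"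
  using smult_l_distr[of a 0 0] smult_closed[of a 0] by (metis add.r_cancel_one' add_0_right)

lemma smult_zero [simp]: "c \<odot> \<zero> = \<zero>"
  using smult_r_distr[of \<zero> \<zero> c] by (metis add.r_cancel_one' l_zero smult_closed zero_closed)

lemma smult_minus: "a \<in> carrier A \<Longrightarrow> \<ominus> (c \<odot> a) = (- c) \<odot> a"
  by (metis add.inv_equality add.left_inverse smult_0 smult_closed smult_l_distr)

lemma smult_minus_r: "a \<in> carrier A \<Longrightarrow> c \<odot> (\<ominus> a) = (- c) \<odot> a"
  by (metis add.inv_closed mult.right_neutral mult_minus_right smult_1 smult_minus smult_smult)

lemma smult_diff_l: "a \<in> carrier A \<Longrightarrow> (c \<odot> a) \<ominus> (d \<odot> a) = (c - d) \<odot> a"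
  by (simp add: minus_eq smult_minus flip: smult_l_distr)

lemma smult_diff_r:
  "a \<in> carrier A \<Longrightarrow> b \<in> carrier A \<Longrightarrow> c \<odot> (a \<ominus> b) = (c \<odot> a) \<ominus> (c \<odot> b)"
  by (simp add: minus_eq smult_minus smult_r_distr smult_minus_r)

lemma smult_finsum:
  "f \<in> S \<rightarrow> carrier A \<Longrightarrow> c \<odot> (\<Oplus>i\<in>S. f i) = (\<Oplus>i\<in>S. c \<odot> f i)"
proof (induction S rule: infinite_finite_induct)
  case (insert i S)
  then have "f \<in> S \<rightarrow> carrier A" "f i \<in> carrier A" "(\<lambda>i. c \<odot> f i) \<in> S \<rightarrow> carrier A"
    by auto
  with insert show ?case by (simp add: smult_r_distr)
qed auto

lemma finsum_smult:
  "a \<in> carrier A \<Longrightarrow> (\<Oplus>i\<in>S. c i \<odot> a) = (\<Sum>i\<in>S. c i) \<odot> a"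
  by (induction S rule: infinite_finite_induct) (auto simp: smult_l_distr Pi_def)

end

lemma alg_homI:
  assumes "\<And>a. a \<in> carrier A \<Longrightarrow> h a \<in> carrier B"
    and "\<And>a b. a \<in> carrier A \<Longrightarrow> b \<in> carrier A \<Longrightarrow> h (a \<otimes>\<^bsub>A\<^esub> b) = h a \<otimes>\<^bsub>B\<^esub> h b"
    and "\<And>a b. a \<in> carrier A \<Longrightarrow> b \<in> carrier A \<Longrightarrow> h (a \<oplus>\<^bsub>A\<^esub> b) = h a \<oplus>\<^bsub>B\<^esub> h b"
    and "h \<one>\<^bsub>A\<^esub> = \<one>\<^bsub>B\<^esub>"
    and "\<And>c a. a \<in> carrier A \<Longrightarrow> h (c \<odot>\<^bsub>A\<^esub> a) = c \<odot>\<^bsub>B\<^esub> h a"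
  shows "h \<in> alg_hom A B"
  using assms by (auto simp: alg_hom_def intro!: ring_hom_memI)

lemma alg_homD:
  assumes "h \<in> alg_hom A B"
  shows "a \<in> carrier A \<Longrightarrow> h a \<in> carrier B"
    and "a \<in> carrier A \<Longrightarrow> b \<in> carrier A \<Longrightarrow> h (a \<otimes>\<^bsub>A\<^esub> b) = h a \<otimes>\<^bsub>B\<^esub> h b"
    and "a \<in> carrier A \<Longrightarrow> b \<in> carrier A \<Longrightarrow> h (a \<oplus>\<^bsub>A\<^esub> b) = h a \<oplus>\<^bsub>B\<^esub> h b"
    and "h \<one>\<^bsub>A\<^esub> = \<one>\<^bsub>B\<^esub>"
    and "a \<in> carrier A \<Longrightarrow> h (c \<odot>\<^bsub>A\<^esub> a) = c \<odot>\<^bsub>B\<^esub> h a"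
  using assms by (auto simp: alg_hom_def ring_hom_closed ring_hom_mult ring_hom_add ring_hom_one)

lemma alg_hom_comp: "h \<in> alg_hom A B \<Longrightarrow> k \<in> alg_hom B C \<Longrightarrow> k \<circ> h \<in> alg_hom A C"
  by (rule alg_homI) (simp_all add: alg_homD)

locale alg_hom_pair = A: nc_algebra A + B: nc_algebra B
  for A :: "('k::field, 'a) module" and B :: "('k, 'b) module" +
  fixes h assumes hom: "h \<in> alg_hom A B"
begin

lemmas hom_simps [simp] = alg_homD[OF hom]

lemma hom_zero [simp]: "h \<zero>\<^bsub>A\<^esub> = \<zero>\<^bsub>B\<^esub>"
  using hom_simps(5)[of "\<zero>\<^bsub>A\<^esub>" 0] by simp

lemma hom_minus: "a \<in> carrier A \<Longrightarrow> h (\<ominus>\<^bsub>A\<^esub> a) = \<ominus>\<^bsub>B\<^esub> h a"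
  using A.smult_minus[of a 1] B.smult_minus[of "h a" 1] by simp

lemma hom_diff [simp]:
  "a \<in> carrier A \<Longrightarrow> b \<in> carrier A \<Longrightarrow> h (a \<ominus>\<^bsub>A\<^esub> b) = h a \<ominus>\<^bsub>B\<^esub> h b"
  by (simp add: a_minus_def hom_minus)

lemma hom_finsum:
  "f \<in> S \<rightarrow> carrier A \<Longrightarrow> h (\<Oplus>\<^bsub>A\<^esub>i\<in>S. f i) = (\<Oplus>\<^bsub>B\<^esub>i\<in>S. h (f i))"
proof (induction S rule: infinite_finite_induct)
  case (insert i S)
  then have "f \<in> S \<rightarrow> carrier A" "f i \<in> carrier A" "(\<lambda>i. h (f i)) \<in> S \<rightarrow> carrier B"
    by (auto simp: Pi_iff)
  with insert show ?case by (simp add: Pi_iff)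
qed auto

lemma hom_commutator:
  "a \<in> carrier A \<Longrightarrow> b \<in> carrier A \<Longrightarrow> h (commutator A a b) = commutator B (h a) (h b)"
  by (simp add: commutator_def)

lemma hom_q_commutator:
  "a \<in> carrier A \<Longrightarrow> b \<in> carrier A \<Longrightarrow> h (q_commutator A r a b) = q_commutator B r (h a) (h b)"
  by (simp add: q_commutator_def)

end

lemma alg_hom_pairI: "nc_algebra A \<Longrightarrow> nc_algebra B \<Longrightarrow> h \<in> alg_hom A B \<Longrightarrow> alg_hom_pair A B h"
  by (intro alg_hom_pair.intro alg_hom_pair_axioms.intro)

text \<open>Every axiom is an equation or an existence claim, so it passes to a surjective image.
  Preservation of zero is a separate assumption because \<open>ring_hom\<close> does not mention it,
  and deriving it would presuppose that \<open>B\<close> is already a group.\<close>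

lemma (in nc_algebra) nc_algebra_surj:
  assumes h: "h \<in> alg_hom A B" "h \<zero> = \<zero>\<^bsub>B\<^esub>" and surj: "carrier B = h ` carrier A"
  shows "nc_algebra B"
proof -
  note hs = alg_homD[OF h(1)]
  have z: "\<zero>\<^bsub>B\<^esub> = h \<zero>" using h(2) by simp
  have inv: "\<exists>y\<in>carrier B. y \<oplus>\<^bsub>B\<^esub> b = \<zero>\<^bsub>B\<^esub>" if b: "b \<in> carrier B" for b
  proof -
    obtain a where "a \<in> carrier A" "b = h a" using b surj by auto
    then show ?thesis
      by (intro bexI[of _ "h (\<ominus> a)"]) (auto simp: hs(1) l_neg z simp flip: hs(3))
  qed
  have "ring B"
  proof (intro ringI abelian_groupI monoidI)
  qed (insert inv, auto simp: surj m_assoc a_ac l_distr r_distr z hs(4)[symmetric]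
         simp flip: hs(2,3))
  then show ?thesis
    by (intro nc_algebra.intro nc_algebra_axioms.intro)
       (auto simp: surj smult_l_distr smult_r_distr smult_smult smult_mult_l smult_mult_r
         simp flip: hs(2,3,5))
qed

section \<open>Quotients by relations\<close>

context nc_algebra
begin

text \<open>A scalar acts as left multiplication by the ring element c 1, so ring ideals are
  automatically subspaces.\<close>

lemma ideal_smult_closed:
  assumes "ideal I A" "x \<in> I" shows "c \<odot> x \<in> I"
proof -
  have x: "x \<in> carrier A"
    using assms by (simp add: ideal.Icarr)
  have "(c \<odot> \<one>) \<otimes> x \<in> I"
    using assms by (intro ideal.I_l_closed) auto
  with x show ?thesis by (simp add: smult_mult_l)
qed

text \<open>The quotient scalar multiplication is encoded as a union over all representatives. By
  closure of the ideal under scalars each of them contributes the same coset, so the union is that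
  coset.\<close>

lemma quot_smult:
  assumes I: "ideal I A" and a: "a \<in> carrier A"
  shows "c \<odot>\<^bsub>quot_algebra A I\<^esub> (I +> a) = I +> (c \<odot> a)"
proof -
  interpret I: ideal I A by (rule I)
  have "I +> (c \<odot> x) = I +> (c \<odot> a)" if x: "x \<in> I +> a" for x
  proof -
    obtain i where i: "i \<in> I" "x = i \<oplus> a"
      using x by (auto simp: a_r_coset_def r_coset_def)
    then have "c \<odot> x = c \<odot> i \<oplus> c \<odot> a"
      using a I.Icarr by (simp add: smult_r_distr)
    moreover have "c \<odot> i \<in> I" using i I ideal_smult_closed by blast
    ultimately have "c \<odot> x \<in> I +> (c \<odot> a)" by (auto simp: a_r_coset_def r_coset_def)
    then show ?thesis
      by (rule a_repr_independence[OF _ smult_closed[OF a] I.a_subgroup, symmetric])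
  qed
  moreover have "a \<in> I +> a" using I.a_rcos_self a by blast
  ultimately have "(\<Union>x\<in>I +> a. I +> (c \<odot> x)) = I +> (c \<odot> a)" by blast
  then show ?thesis by (simp add: quot_algebra_def)
qed

lemma quot_alg_hom:
  assumes I: "ideal I A" shows "(+>) I \<in> alg_hom A (quot_algebra A I)"
proof -
  interpret I: ideal I A by (rule I)
  have "(+>) I \<in> ring_hom A (quot_algebra A I)"
    using I.rcos_ring_hom unfolding ring_hom_def by (simp add: quot_algebra_def)
  then show ?thesis by (simp add: alg_hom_def quot_smult I)
qed

lemma quot_carrier: "carrier (quot_algebra A I) = (+>) I ` carrier A"
  by (auto simp: quot_algebra_def FactRing_def A_RCOSETS_def RCOSETS_def a_r_coset_def)

lemma quot_nc_algebra:
  assumes I: "ideal I A" shows "nc_algebra (quot_algebra A I)"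
proof -
  interpret I: ideal I A by (rule I)
  have "I +> \<zero> = \<zero>\<^bsub>quot_algebra A I\<^esub>"
    using I.a_subset by (simp add: quot_algebra_def FactRing_def)
  then show ?thesis
    by (rule nc_algebra_surj[OF quot_alg_hom[OF I] _ quot_carrier])
qed

end

locale relations = nc_algebra A for A :: "('k::field, 'a) module" (structure) +
  fixes R assumes rel_carrier: "R \<subseteq> carrier A \<times> carrier A"
begin

abbreviation "relI \<equiv> Idl\<^bsub>A\<^esub> {l \<ominus>\<^bsub>A\<^esub> r | l r. (l, r) \<in> R}"

lemma rel_ideal: "ideal relI A"
  using rel_carrier by (intro genideal_ideal) auto

lemma rel_nc_algebra: "nc_algebra (quot_by_relations A R)"
  unfolding quot_by_relations_def by (rule quot_nc_algebra[OF rel_ideal])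

lemma rel_class_hom: "rel_class A R \<in> alg_hom A (quot_by_relations A R)"
  using quot_alg_hom[OF rel_ideal] unfolding quot_by_relations_def rel_class_def[abs_def] .

lemma rel_class_surj: "carrier (quot_by_relations A R) = rel_class A R ` carrier A"
  unfolding quot_by_relations_def rel_class_def[abs_def] by (rule quot_carrier)

sublocale cl: alg_hom_pair A "quot_by_relations A R" "rel_class A R"
  using nc_algebra_axioms rel_nc_algebra rel_class_hom by (rule alg_hom_pairI)

lemma rel_class_rel:
  assumes lr: "(l, r) \<in> R" shows "rel_class A R l = rel_class A R r"
proof -
  interpret I: ideal relI A by (rule rel_ideal)
  have c: "l \<in> carrier A" "r \<in> carrier A" using lr rel_carrier by auto
  have "l \<ominus> r \<in> relI" using lr rel_carrier by (intro subsetD[OF genideal_self]) auto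
  moreover have "l = (l \<ominus> r) \<oplus> r" using c by (simp add: minus_eq a_assoc l_neg)
  ultimately have "l \<in> relI +> r" by (auto simp: a_r_coset_def r_coset_def)
  then show ?thesis
    unfolding rel_class_def by (rule a_repr_independence[OF _ c(2) I.a_subgroup, symmetric])
qed

text \<open>The kernel of \<open>h\<close> is an ideal containing all differences l - r, hence
  contains the ideal they generate. So \<open>h\<close> is constant on each class.\<close>

lemma rel_class_eqD:
  assumes B: "nc_algebra B" and h: "h \<in> alg_hom A B" and kills: "\<And>l r. (l, r) \<in> R \<Longrightarrow> h l = h r"
    and b: "b \<in> carrier A" and a: "a \<in> rel_class A R b"
  shows "h a = h b"
proof -
  interpret h: alg_hom_pair A B h
    using nc_algebra_axioms B h by (rule alg_hom_pairI)
  interpret hr: ring_hom_ring A B h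
    using h by (intro ring_hom_ringI2 ring_axioms h.B.ring_axioms) (simp add: alg_hom_def)
  have "{l \<ominus> r | l r. (l, r) \<in> R} \<subseteq> a_kernel A B h"
  proof
    fix x assume "x \<in> {l \<ominus> r | l r. (l, r) \<in> R}"
    then obtain l r where lr: "(l, r) \<in> R" "x = l \<ominus> r" by blast
    moreover from lr rel_carrier have "l \<in> carrier A" "r \<in> carrier A" by auto
    ultimately have "x \<in> carrier A" "h x = h r \<ominus>\<^bsub>B\<^esub> h r" "h r \<in> carrier B"
      using kills[OF lr(1)] by simp_all
    then show "x \<in> a_kernel A B h"
      unfolding a_kernel_def' by (simp add: a_minus_def h.B.r_neg)
  qed
  then have "relI \<subseteq> a_kernel A B h"
    by (intro genideal_minimal hr.kernel_is_ideal)
  moreover obtain i where "i \<in> relI" "a = i \<oplus> b"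
    using a by (auto simp: a_r_coset_def r_coset_def rel_class_def)
  ultimately have "i \<in> carrier A" "h i = \<zero>\<^bsub>B\<^esub>" "a = i \<oplus> b"
    unfolding a_kernel_def' by blast+
  then show ?thesis using b by simp
qed

text \<open>Universal property of the quotient, existence half: a class goes to the value of
  \<open>h\<close> at a chosen representative, and \<open>rel_class_eqD\<close> makes the choice
  irrelevant.\<close>

lemma rel_lift:
  assumes B: "nc_algebra B" and h: "h \<in> alg_hom A B" and kills: "\<And>l r. (l, r) \<in> R \<Longrightarrow> h l = h r"
  obtains h' where "h' \<in> alg_hom (quot_by_relations A R) B"
    and "\<And>a. a \<in> carrier A \<Longrightarrow> h' (rel_class A R a) = h a"
proof -
  define h' where "h' X = h (SOME a. a \<in> carrier A \<and> rel_class A R a = X)" for X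
  interpret I: ideal relI A by (rule rel_ideal)
  have h': "h' (rel_class A R a) = h a" if "a \<in> carrier A" for a
  proof -
    define b where "b = (SOME b. b \<in> carrier A \<and> rel_class A R b = rel_class A R a)"
    have b: "b \<in> carrier A \<and> rel_class A R b = rel_class A R a"
      unfolding b_def by (rule someI[of _ a]) (use that in simp)
    then have "b \<in> rel_class A R a" using I.a_rcos_self[of b] by (auto simp: rel_class_def)
    with that b show ?thesis
      unfolding h'_def b_def[symmetric] by (intro rel_class_eqD[OF B h kills])
  qed
  have "h' \<in> alg_hom (quot_by_relations A R) B"
    by (rule alg_homI)
       (auto simp: rel_class_surj h' alg_homD[OF h]
             simp flip: cl.hom_simps(2-5))
  with h' show thesis by (rule that[rotated])
qed

text \<open>Uniqueness half, for any set \<open>S\<close> that determines homomorphisms out of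
  \<open>A\<close>; it descends to the quotient because the class map is surjective.\<close>

lemma rel_hom_unique:
  assumes "h \<in> alg_hom (quot_by_relations A R) B" "h' \<in> alg_hom (quot_by_relations A R) B"
    and "\<And>k k'. k \<in> alg_hom A B \<Longrightarrow> k' \<in> alg_hom A B \<Longrightarrow>
           (\<And>a. a \<in> S \<Longrightarrow> k a = k' a) \<Longrightarrow> (\<And>a. a \<in> carrier A \<Longrightarrow> k a = k' a)"
    and "\<And>a. a \<in> S \<Longrightarrow> h (rel_class A R a) = h' (rel_class A R a)"
    and "a \<in> carrier (quot_by_relations A R)"
  shows "h a = h' a"
  using assms(3)[OF alg_hom_comp[OF rel_class_hom assms(1)] alg_hom_comp[OF rel_class_hom assms(2)]]
    assms(4,5) by (auto simp: rel_class_surj)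

end

section \<open>Monoid algebras\<close>

abbreviation supp :: "('m \<Rightarrow> 'k::zero) \<Rightarrow> 'm set" where
  "supp f \<equiv> {m. f m \<noteq> 0}"

lemma monoid_algebra_simps [simp]:
  "carrier (monoid_algebra M) = {f. finite (supp f) \<and> supp f \<subseteq> carrier M}"
  "\<zero>\<^bsub>monoid_algebra M\<^esub> = (\<lambda>_. 0)"
  "\<one>\<^bsub>monoid_algebra M\<^esub> = basis_elem \<one>\<^bsub>M\<^esub>"
  "f \<oplus>\<^bsub>monoid_algebra M\<^esub> g = (\<lambda>m. f m + g m)"
  "c \<odot>\<^bsub>monoid_algebra M\<^esub> f = (\<lambda>m. c * f m)"
  by (auto simp: monoid_algebra_def basis_elem_def)

abbreviation conv :: "('m, 'c) monoid_scheme \<Rightarrow> ('m \<Rightarrow> 'k::field) \<Rightarrow> ('m \<Rightarrow> 'k) \<Rightarrow> 'm \<Rightarrow> 'k" where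
  "conv M f g \<equiv> f \<otimes>\<^bsub>monoid_algebra M\<^esub> g"

lemma conv_eq:
  "conv M f g m = (\<Sum>(u, v)\<in>supp f \<times> supp g. if u \<otimes>\<^bsub>M\<^esub> v = m then f u * g v else 0)"
  by (simp add: monoid_algebra_def)

text \<open>
  A finitely supported function is determined by its pairings with arbitrary functions, and
  convolution is dual to the multiplication of the monoid; this gives associativity.
\<close>

definition pair :: "('m \<Rightarrow> 'k::field) \<Rightarrow> ('m \<Rightarrow> 'k) \<Rightarrow> 'k" where
  "pair f h = (\<Sum>u\<in>supp f. f u * h u)"

lemma pair_superset: "finite S \<Longrightarrow> supp f \<subseteq> S \<Longrightarrow> pair f h = (\<Sum>u\<in>S. f u * h u)"
  unfolding pair_def by (intro sum.mono_neutral_left) auto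

text \<open>Pairing with the indicator function of a point m returns the coefficient at m.\<close>

lemma pair_eqI:
  assumes "\<And>h. pair f h = pair g h" "finite (supp f)" "finite (supp g)" shows "f = g"
proof
  fix m
  have *: "pair k (\<lambda>u. if u = m then 1 else 0) = k m" if "finite (supp k)" for k :: "'a \<Rightarrow> 'b"
    unfolding pair_def using that by (simp add: if_distrib[where f = "(*) _"] sum.delta cong: if_cong)
  show "f m = g m" using assms *[of f] *[of g] by metis
qed

lemma conv_supp: "supp (conv M f g) \<subseteq> (\<lambda>(u, v). u \<otimes>\<^bsub>M\<^esub> v) ` (supp f \<times> supp g)"
proof
  fix m assume "m \<in> supp (conv M f g)"
  then have "(\<Sum>(u, v)\<in>supp f \<times> supp g. if u \<otimes>\<^bsub>M\<^esub> v = m then f u * g v else 0) \<noteq> 0"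
    by (simp add: conv_eq)
  then obtain u v where "u \<in> supp f" "v \<in> supp g" "u \<otimes>\<^bsub>M\<^esub> v = m"
    by (auto elim!: sum.not_neutral_contains_not_neutral split: if_splits)
  then show "m \<in> (\<lambda>(u, v). u \<otimes>\<^bsub>M\<^esub> v) ` (supp f \<times> supp g)" by force
qed

text \<open>Each pair (u, v) contributes to exactly one coefficient of the convolution, the one at
  its product, so after exchanging the summations the inner sum collapses to a single term.\<close>

lemma pair_conv:
  assumes f: "finite (supp f)" and g: "finite (supp g)"
  shows "pair (conv M f g) h = pair f (\<lambda>u. pair g (\<lambda>v. h (u \<otimes>\<^bsub>M\<^esub> v)))"
proof -
  let ?P = "supp f \<times> supp g" and ?m = "\<lambda>(u, v). u \<otimes>\<^bsub>M\<^esub> v"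
  have "pair (conv M f g) h = (\<Sum>m\<in>?m ` ?P. conv M f g m * h m)"
    by (rule pair_superset[OF _ conv_supp]) (use f g in auto)
  also have "\<dots> = (\<Sum>m\<in>?m ` ?P. \<Sum>p\<in>?P. if ?m p = m then f (fst p) * g (snd p) * h m else 0)"
    by (intro sum.cong refl) (auto simp: conv_eq sum_distrib_right case_prod_beta intro!: sum.cong)
  also have "\<dots> = (\<Sum>p\<in>?P. \<Sum>m\<in>?m ` ?P. if ?m p = m then f (fst p) * g (snd p) * h m else 0)"
    by (rule sum.swap)
  also have "\<dots> = (\<Sum>p\<in>?P. f (fst p) * g (snd p) * h (?m p))"
    using f g by (intro sum.cong refl) (simp add: sum.delta')
  also have "\<dots> = pair f (\<lambda>u. pair g (\<lambda>v. h (u \<otimes>\<^bsub>M\<^esub> v)))"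
    by (simp add: pair_def sum_distrib_left sum.cartesian_product case_prod_beta mult.assoc)
  finally show ?thesis .
qed

lemma pair_add: "finite (supp f) \<Longrightarrow> finite (supp g) \<Longrightarrow> pair (\<lambda>m. f m + g m) h = pair f h + pair g h"
  by (subst (1 2 3) pair_superset[of "supp f \<union> supp g"]) (auto simp: sum.distrib distrib_right)

lemma pair_scale: "finite (supp f) \<Longrightarrow> pair (\<lambda>m. c * f m) h = c * pair f h"
  by (subst (1 2) pair_superset[of "supp f"]) (auto simp: sum_distrib_left mult.assoc)

lemma pair_arg_add: "pair f (\<lambda>m. h m + k m) = pair f h + pair f k"
  by (simp add: pair_def sum.distrib distrib_left)

lemma pair_arg_scale: "pair f (\<lambda>m. c * h m) = c * pair f h"
  by (simp add: pair_def sum_distrib_left mult_ac)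

lemma supp_basis_elem [simp]: "supp (basis_elem m :: 'm \<Rightarrow> 'k::field) = {m}"
  by (auto simp: basis_elem_def)

lemma pair_basis_elem [simp]: "pair (basis_elem m) h = h m"
  by (simp add: pair_def) (simp add: basis_elem_def)

lemma pair_cong: "(\<And>u. u \<in> supp f \<Longrightarrow> h u = k u) \<Longrightarrow> pair f h = pair f k"
  by (simp add: pair_def)

lemma finite_supp_add [simp]:
  "finite (supp f) \<Longrightarrow> finite (supp g) \<Longrightarrow> finite (supp (\<lambda>m. f m + g m :: 'k::field))"
  by (rule finite_subset[of _ "supp f \<union> supp g"]) auto

lemma finite_supp_scale [simp]: "finite (supp f) \<Longrightarrow> finite (supp (\<lambda>m. c * f m :: 'k::field))"
  by (rule finite_subset[of _ "supp f"]) auto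

lemma finite_supp_conv [simp]:
  "finite (supp f) \<Longrightarrow> finite (supp g) \<Longrightarrow> finite (supp (conv M f g))"
  by (rule finite_subset[OF conv_supp]) auto

lemma conv_basis_elem: "conv M (basis_elem u) (basis_elem v) = (basis_elem (u \<otimes>\<^bsub>M\<^esub> v) :: _ \<Rightarrow> 'k::field)"
  by (rule pair_eqI) (simp_all add: pair_conv)

context monoid
begin

text \<open>The multiplicative laws are tested by pairing: \<open>pair_conv\<close> turns them into
  the monoid laws applied to the argument of the test function.\<close>

lemma monoid_algebra_nc_algebra: "nc_algebra (monoid_algebra G :: ('k::field, 'a \<Rightarrow> 'k) module)"
proof -
  let ?A = "monoid_algebra G :: ('k, 'a \<Rightarrow> 'k) module"
  have closed: "conv G f g \<in> carrier ?A" if "f \<in> carrier ?A" "g \<in> carrier ?A" for f g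
    using that conv_supp[of G f g] by (auto simp: subset_iff split: prod.splits)
  have neg: "\<exists>g\<in>carrier ?A. g \<oplus>\<^bsub>?A\<^esub> f = \<zero>\<^bsub>?A\<^esub>" if "f \<in> carrier ?A" for f
    using that by (intro bexI[of _ "\<lambda>m. - f m"]) auto
  have "ring ?A"
  proof (intro ringI abelian_groupI monoidI)
    show "conv G (conv G f g) h = conv G f (conv G g h)"
      if "f \<in> carrier ?A" "g \<in> carrier ?A" "h \<in> carrier ?A" for f g h
      using that by (intro pair_eqI) (auto simp: pair_conv m_assoc subset_iff intro!: pair_cong)
    show "conv G \<one>\<^bsub>?A\<^esub> f = f" if "f \<in> carrier ?A" for f
      using that by (intro pair_eqI) (auto simp: pair_conv subset_iff intro!: pair_cong)
    show "conv G f \<one>\<^bsub>?A\<^esub> = f" if "f \<in> carrier ?A" for f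
      using that by (intro pair_eqI) (auto simp: pair_conv subset_iff intro!: pair_cong)
    show "conv G (f \<oplus>\<^bsub>?A\<^esub> g) h = conv G f h \<oplus>\<^bsub>?A\<^esub> conv G g h"
      if "f \<in> carrier ?A" "g \<in> carrier ?A" "h \<in> carrier ?A" for f g h
      using that by (intro pair_eqI) (auto simp: pair_conv pair_add)
    show "conv G h (f \<oplus>\<^bsub>?A\<^esub> g) = conv G h f \<oplus>\<^bsub>?A\<^esub> conv G h g"
      if "f \<in> carrier ?A" "g \<in> carrier ?A" "h \<in> carrier ?A" for f g h
      using that by (intro pair_eqI) (auto simp: pair_conv pair_add pair_arg_add)
    show "f \<oplus>\<^bsub>?A\<^esub> g \<in> carrier ?A" if "f \<in> carrier ?A" "g \<in> carrier ?A" for f g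
      using that by (auto simp: subset_iff) (metis add_0)
  qed (use closed neg in \<open>auto simp: add_ac\<close>)
  moreover have "conv G (c \<odot>\<^bsub>?A\<^esub> f) g = c \<odot>\<^bsub>?A\<^esub> conv G f g"
    if "f \<in> carrier ?A" "g \<in> carrier ?A" for c f g
    using that by (intro pair_eqI) (auto simp: pair_conv pair_scale)
  moreover have "conv G f (c \<odot>\<^bsub>?A\<^esub> g) = c \<odot>\<^bsub>?A\<^esub> conv G f g"
    if "f \<in> carrier ?A" "g \<in> carrier ?A" for c f g
    using that by (intro pair_eqI) (auto simp: pair_conv pair_scale pair_arg_scale)
  ultimately show ?thesis
    by (intro nc_algebra.intro nc_algebra_axioms.intro) (auto simp: algebra_simps)
qed

lemma basis_elem_carrier [simp]: "m \<in> carrier G \<Longrightarrow> basis_elem m \<in> carrier (monoid_algebra G)"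
  by simp

end

text \<open>Induction on the finite support, splitting off one scaled basis element at a
  time.\<close>

lemma monoid_algebra_induct [consumes 1, case_names zero add]:
  assumes f: "f \<in> carrier (monoid_algebra M)"
    and zero: "P (\<lambda>_. 0)"
    and add: "\<And>c m f. m \<in> carrier M \<Longrightarrow> f \<in> carrier (monoid_algebra M) \<Longrightarrow> P f \<Longrightarrow>
      P ((c \<odot>\<^bsub>monoid_algebra M\<^esub> basis_elem m) \<oplus>\<^bsub>monoid_algebra M\<^esub> f)"
  shows "P f"
proof -
  have *: "finite S \<Longrightarrow> supp f = S \<Longrightarrow> S \<subseteq> carrier M \<Longrightarrow> P f" for S f
  proof (induction S arbitrary: f rule: finite_induct)
    case empty
    then have "f = (\<lambda>_. 0)" by auto
    with zero show ?case by simp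
  next
    case (insert m S)
    define g where "g = f(m := 0)"
    have g: "supp g = S" using insert by (auto simp: g_def)
    have "f = (f m \<odot>\<^bsub>monoid_algebra M\<^esub> basis_elem m) \<oplus>\<^bsub>monoid_algebra M\<^esub> g"
      by (auto simp: g_def basis_elem_def fun_eq_iff)
    moreover have "P \<dots>"
      using insert g by (intro add) auto
    ultimately show ?case by simp
  qed
  show ?thesis using f by (intro *[OF _ refl]) simp_all
qed

lemma monoid_algebra_hom_unique:
  fixes B :: "('k::field, 'b) module"
  assumes M: "monoid M" and B: "nc_algebra B"
    and "h \<in> alg_hom (monoid_algebra M) B" "h' \<in> alg_hom (monoid_algebra M) B"
    and eq: "\<And>m. m \<in> carrier M \<Longrightarrow> h (basis_elem m) = h' (basis_elem m)"
    and f: "f \<in> carrier (monoid_algebra M)"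
  shows "h f = h' f"
proof -
  interpret h: alg_hom_pair "monoid_algebra M" B h
    by (intro alg_hom_pair.intro alg_hom_pair_axioms.intro monoid.monoid_algebra_nc_algebra assms)
  interpret h': alg_hom_pair "monoid_algebra M" B h'
    by (intro alg_hom_pair.intro alg_hom_pair_axioms.intro monoid.monoid_algebra_nc_algebra assms)
  from f show ?thesis
  proof (induction rule: monoid_algebra_induct)
    case zero
    then show ?case using h.hom_zero h'.hom_zero by simp
  next
    case (add c m f)
    have "basis_elem m \<in> carrier (monoid_algebra M)" using add by simp
    with add show ?case
      using eq h.hom_simps(3,5) h'.hom_simps(3,5) h.A.smult_closed
      by (metis (no_types, lifting))
  qed
qed

text \<open>The linear extension of \<beta> from the monoid to its algebra. Free algebras and the
  map setting variables to zero both use it.\<close>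

definition mext :: "('k::field, 'b) module \<Rightarrow> ('m \<Rightarrow> 'b) \<Rightarrow> ('m \<Rightarrow> 'k) \<Rightarrow> 'b" where
  "mext B \<beta> f = (\<Oplus>\<^bsub>B\<^esub>u\<in>supp f. f u \<odot>\<^bsub>B\<^esub> \<beta> u)"

locale monoid_rep = M: monoid M + B: nc_algebra B
  for M :: "('m, 'c) monoid_scheme" and B :: "('k::field, 'b) module" +
  fixes \<beta>
  assumes rep_closed: "m \<in> carrier M \<Longrightarrow> \<beta> m \<in> carrier B"
    and rep_mult: "m \<in> carrier M \<Longrightarrow> n \<in> carrier M \<Longrightarrow> \<beta> (m \<otimes>\<^bsub>M\<^esub> n) = \<beta> m \<otimes>\<^bsub>B\<^esub> \<beta> n"
    and rep_one: "\<beta> \<one>\<^bsub>M\<^esub> = \<one>\<^bsub>B\<^esub>"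
begin

sublocale MA: nc_algebra "monoid_algebra M :: ('k, 'm \<Rightarrow> 'k) module"
  by (rule M.monoid_algebra_nc_algebra)

lemma mext_superset:
  assumes "finite S" "supp f \<subseteq> S" "S \<subseteq> carrier M"
  shows "mext B \<beta> f = (\<Oplus>\<^bsub>B\<^esub>u\<in>S. f u \<odot>\<^bsub>B\<^esub> \<beta> u)"
  unfolding mext_def using assms rep_closed
  by (intro B.add.finprod_mono_neutral_cong_left) auto

lemma mext_closed: "f \<in> carrier (monoid_algebra M) \<Longrightarrow> mext B \<beta> f \<in> carrier B"
  unfolding mext_def using rep_closed by (intro B.finsum_closed) auto

lemma mext_basis_elem: "m \<in> carrier M \<Longrightarrow> mext B \<beta> (basis_elem m) = \<beta> m"
  using rep_closed by (simp add: mext_def) (simp add: basis_elem_def)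

lemma mext_add:
  assumes "f \<in> carrier (monoid_algebra M)" "g \<in> carrier (monoid_algebra M)"
  shows "mext B \<beta> (f \<oplus>\<^bsub>monoid_algebra M\<^esub> g) = mext B \<beta> f \<oplus>\<^bsub>B\<^esub> mext B \<beta> g"
proof -
  let ?S = "supp f \<union> supp g"
  have S: "finite ?S" "?S \<subseteq> carrier M" "supp (\<lambda>m. f m + g m) \<subseteq> ?S"
    using assms by auto
  have [simp]: "\<beta> u \<in> carrier B" if "u \<in> ?S" for u
    using S(2) that rep_closed by blast
  have "mext B \<beta> (\<lambda>m. f m + g m) = (\<Oplus>\<^bsub>B\<^esub>u\<in>?S. f u \<odot>\<^bsub>B\<^esub> \<beta> u \<oplus>\<^bsub>B\<^esub> g u \<odot>\<^bsub>B\<^esub> \<beta> u)"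
    by (subst mext_superset[OF S(1,3,2)]) (intro B.finsum_cong, auto simp: B.smult_l_distr)
  also have "\<dots> = (\<Oplus>\<^bsub>B\<^esub>u\<in>?S. f u \<odot>\<^bsub>B\<^esub> \<beta> u) \<oplus>\<^bsub>B\<^esub> (\<Oplus>\<^bsub>B\<^esub>u\<in>?S. g u \<odot>\<^bsub>B\<^esub> \<beta> u)"
    by (rule B.finsum_addf) auto
  also have "\<dots> = mext B \<beta> f \<oplus>\<^bsub>B\<^esub> mext B \<beta> g"
    using S by (subst (1 2) mext_superset[of ?S]) auto
  finally show ?thesis by simp
qed

lemma mext_smult:
  assumes "f \<in> carrier (monoid_algebra M)"
  shows "mext B \<beta> (c \<odot>\<^bsub>monoid_algebra M\<^esub> f) = c \<odot>\<^bsub>B\<^esub> mext B \<beta> f"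
  using assms rep_closed
  by (subst (1 2) mext_superset[of "supp f"])
     (auto simp: B.smult_finsum B.smult_smult subset_iff Pi_iff intro!: B.finsum_cong)

text \<open>On two basis elements this is multiplicativity of \<beta>. Linearity extends it first in
  the right factor, then in the left one.\<close>

lemma mext_mult:
  assumes f: "f \<in> carrier (monoid_algebra M)" and g: "g \<in> carrier (monoid_algebra M)"
  shows "mext B \<beta> (conv M f g) = mext B \<beta> f \<otimes>\<^bsub>B\<^esub> mext B \<beta> g"
proof -
  have zero: "mext B \<beta> \<zero>\<^bsub>monoid_algebra M\<^esub> = \<zero>\<^bsub>B\<^esub>" by (simp add: mext_def)
  note closed = mext_closed mext_add mext_smult mext_basis_elem M.basis_elem_carrier
    MA.smult_closed MA.add.m_closed MA.m_closed rep_closed rep_mult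
  have basis: "mext B \<beta> (conv M (basis_elem m) g) = \<beta> m \<otimes>\<^bsub>B\<^esub> mext B \<beta> g"
    if m: "m \<in> carrier M" for m
    using g
  proof (induction rule: monoid_algebra_induct)
    case zero
    show ?case
      using m rep_closed \<open>mext B \<beta> \<zero>\<^bsub>monoid_algebra M\<^esub> = \<zero>\<^bsub>B\<^esub>\<close> MA.r_null[of "basis_elem m"] by simp
  next
    case (add c n g)
    with m show ?case
      by (simp add: MA.r_distr MA.smult_mult_r closed conv_basis_elem B.r_distr B.smult_mult_r
          del: monoid_algebra_simps)
  qed
  from f show ?thesis
  proof (induction rule: monoid_algebra_induct)
    case zero
    show ?case
      using g mext_closed \<open>mext B \<beta> \<zero>\<^bsub>monoid_algebra M\<^esub> = \<zero>\<^bsub>B\<^esub>\<close> MA.l_null[of g] by simp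
  next
    case (add c m f)
    with g show ?case
      by (simp add: MA.l_distr MA.smult_mult_l closed basis B.l_distr B.smult_mult_l
          del: monoid_algebra_simps)
  qed
qed

lemma mext_hom: "mext B \<beta> \<in> alg_hom (monoid_algebra M) B"
  by (rule alg_homI)
     (use mext_closed mext_add mext_mult mext_smult mext_basis_elem[of "\<one>\<^bsub>M\<^esub>"] rep_one
      in \<open>simp_all del: monoid_algebra_simps(1,2,4,5)\<close>)

end

section \<open>Presented algebras\<close>

abbreviation word_monoid :: "'g list monoid" where
  "word_monoid \<equiv> \<lparr>carrier = UNIV, monoid.mult = (@), one = []\<rparr>"

lemma word_monoid: "monoid word_monoid"
  by (rule monoidI) auto

lemma free_algebra_nc_algebra: "nc_algebra free_algebra"
  unfolding free_algebra_def by (rule monoid.monoid_algebra_nc_algebra[OF word_monoid])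

lemma free_gen_carrier [simp]: "free_gen g \<in> carrier free_algebra"
  by (simp add: free_algebra_def free_gen_def)

text \<open>A word is sent to the product of the images of its letters, which is a monoid
  homomorphism on words; its linear extension is the required map.\<close>

lemma free_hom_exists:
  assumes B: "nc_algebra B" and b: "\<And>g. b g \<in> carrier B"
  obtains h where "h \<in> alg_hom free_algebra B" "\<And>g. h (free_gen g) = b g"
proof -
  interpret B: nc_algebra B by (rule B)
  define \<beta> where "\<beta> xs = foldr (\<lambda>g r. b g \<otimes>\<^bsub>B\<^esub> r) xs \<one>\<^bsub>B\<^esub>" for xs
  have closed: "\<beta> xs \<in> carrier B" for xs
    by (induction xs) (auto simp: \<beta>_def b)
  have mult: "\<beta> (xs @ ys) = \<beta> xs \<otimes>\<^bsub>B\<^esub> \<beta> ys" for xs ys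
    using closed by (induction xs) (auto simp: \<beta>_def b B.m_assoc)
  interpret monoid_rep word_monoid B \<beta>
    by (intro monoid_rep.intro monoid_rep_axioms.intro word_monoid B) (simp_all add: closed mult, simp add: \<beta>_def)
  show thesis
  proof
    show "mext B \<beta> \<in> alg_hom free_algebra B"
      using mext_hom by (simp add: free_algebra_def)
    show "mext B \<beta> (free_gen g) = b g" for g
      by (simp add: free_gen_def mext_basis_elem) (simp add: \<beta>_def b)
  qed
qed

text \<open>Words are products of generators, so induction on length gives agreement on the
  basis.\<close>

lemma free_hom_unique:
  fixes B :: "('k::field, 'b) module" and h :: "('g list \<Rightarrow> 'k) \<Rightarrow> 'b"
  assumes B: "nc_algebra B"
    and h: "h \<in> alg_hom free_algebra B" and h': "h' \<in> alg_hom free_algebra B"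
    and eq: "\<And>g. h (free_gen g) = h' (free_gen g)"
    and f: "f \<in> carrier free_algebra"
  shows "h f = h' f"
proof -
  have "h (basis_elem xs) = h' (basis_elem xs)" for xs
  proof (induction xs)
    case Nil
    show ?case using alg_homD(4)[OF h] alg_homD(4)[OF h'] by (simp add: free_algebra_def)
  next
    case (Cons g xs)
    have "basis_elem (g # xs) = (free_gen g \<otimes>\<^bsub>free_algebra\<^esub> basis_elem xs :: 'g list \<Rightarrow> 'k)"
      by (simp add: free_algebra_def free_gen_def conv_basis_elem)
    moreover have "(basis_elem xs :: 'g list \<Rightarrow> 'k) \<in> carrier free_algebra" by (simp add: free_algebra_def)
    ultimately show ?case
      using Cons eq alg_homD(2)[OF h] alg_homD(2)[OF h'] by simp
  qed
  then show ?thesis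
    by (rule monoid_algebra_hom_unique[OF word_monoid B
          h[unfolded free_algebra_def] h'[unfolded free_algebra_def] _ f[unfolded free_algebra_def]])
qed

locale presentation =
  fixes R :: "(('g list \<Rightarrow> 'k::field) \<times> ('g list \<Rightarrow> 'k)) set"
  assumes R_carrier: "R \<subseteq> carrier free_algebra \<times> carrier free_algebra"
begin

sublocale relations free_algebra R
  by (intro relations.intro relations_axioms.intro free_algebra_nc_algebra R_carrier)

lemma presented_nc_algebra: "nc_algebra (presented_algebra R)"
  unfolding presented_algebra_def by (rule rel_nc_algebra)

lemma presented_gen_carrier [simp]: "presented_gen R g \<in> carrier (presented_algebra R)"
  unfolding presented_algebra_def presented_gen_def by simp

text \<open>The assumption on relations concerns every homomorphism with the prescribed values on
  generators. A user can thus check relations by pushing an abstract \<open>h\<close> inward,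
  without seeing how it was built.\<close>

lemma presented_hom_exists:
  assumes B: "nc_algebra B" and b: "\<And>g. b g \<in> carrier B"
    and kills: "\<And>h l r. alg_hom_pair free_algebra B h \<Longrightarrow> (\<And>g. h (free_gen g) = b g) \<Longrightarrow>
      (l, r) \<in> R \<Longrightarrow> h l = h r"
  obtains h where "h \<in> alg_hom (presented_algebra R) B" "\<And>g. h (presented_gen R g) = b g"
proof -
  obtain h where h: "h \<in> alg_hom free_algebra B" "\<And>g. h (free_gen g) = b g"
    by (rule free_hom_exists[OF B, of b]) (auto simp: b)
  obtain h' where "h' \<in> alg_hom (quot_by_relations free_algebra R) B"
    "\<And>a. a \<in> carrier free_algebra \<Longrightarrow> h' (rel_class free_algebra R a) = h a"
    by (rule rel_lift[OF B h(1) kills[OF alg_hom_pairI[OF nc_algebra_axioms B h(1)] h(2)]]) auto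
  with h(2) show thesis
    by (intro that[of h']) (auto simp: presented_algebra_def presented_gen_def)
qed

lemma presented_hom_unique:
  assumes B: "nc_algebra B"
    and h: "h \<in> alg_hom (presented_algebra R) B" "h' \<in> alg_hom (presented_algebra R) B"
    and eq: "\<And>g. h (presented_gen R g) = h' (presented_gen R g)"
    and a: "a \<in> carrier (presented_algebra R)"
  shows "h a = h' a"
proof (rule rel_hom_unique[of h B h' "range free_gen"])
  show "k a = k' a" if "k \<in> alg_hom free_algebra B" "k' \<in> alg_hom free_algebra B"
    "\<And>a. a \<in> range free_gen \<Longrightarrow> k a = k' a" "a \<in> carrier free_algebra" for k k' a
    by (rule free_hom_unique[OF B that(1,2) that(3)[OF rangeI] that(4)])
qed (use h a eq in \<open>auto simp: presented_algebra_def presented_gen_def\<close>)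

end

section \<open>Polynomial algebras and tensor products\<close>

abbreviation mset_monoid :: "'v set \<Rightarrow> 'v multiset monoid" where
  "mset_monoid V \<equiv> \<lparr>carrier = {m. set_mset m \<subseteq> V}, monoid.mult = (+), one = {#}\<rparr>"

lemma mset_monoid: "monoid (mset_monoid V)"
  by (rule monoidI) auto

lemma poly_algebra_nc_algebra: "nc_algebra (poly_algebra V)"
  unfolding poly_algebra_def by (rule monoid.monoid_algebra_nc_algebra[OF mset_monoid])

text \<open>The constant coefficient is the pairing with the indicator \<delta> of the empty
  multiset. This indicator is multiplicative, since a sum of multisets is empty only if both
  summands are.\<close>

lemma poly_const_coeff:
  assumes "f \<in> carrier (poly_algebra V)" "g \<in> carrier (poly_algebra V)"
  shows "(f \<otimes>\<^bsub>poly_algebra V\<^esub> g) {#} = f {#} * (g {#} :: 'k::field)"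
proof -
  define \<delta> :: "'a multiset \<Rightarrow> 'k" where "\<delta> u = (if u = {#} then 1 else 0)" for u
  have \<delta>: "pair k \<delta> = k {#}" if "finite (supp k)" for k
    unfolding pair_def \<delta>_def using that
    by (simp add: if_distrib[where f = "(*) _"] sum.delta cong: if_cong)
  have "\<delta> (u + v) = \<delta> u * \<delta> v" for u v by (simp add: \<delta>_def)
  then have "pair (conv (mset_monoid V) f g) \<delta> = pair f (\<lambda>u. pair g (\<lambda>v. \<delta> u * \<delta> v))"
    using assms by (simp add: pair_conv poly_algebra_def)
  also have "\<dots> = pair g \<delta> * pair f \<delta>"
    by (simp only: pair_arg_scale mult.commute[of _ "pair g \<delta>"])
  finally show ?thesis
    using assms by (simp add: \<delta> poly_algebra_def mult.commute)
qed

text \<open>Both sides are algebra homomorphisms in f. They agree on monomials: a nonempty one has a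
  variable as a factor, so \<open>h\<close> kills it, and its constant coefficient is zero.\<close>

lemma poly_hom_eval_zero:
  fixes B :: "('k::field, 'b) module" and V :: "'v set"
  assumes B: "nc_algebra B" and h: "h \<in> alg_hom (poly_algebra V) B"
    and zero: "\<And>v. v \<in> V \<Longrightarrow> h (poly_var v) = \<zero>\<^bsub>B\<^esub>"
    and f: "f \<in> carrier (poly_algebra V)"
  shows "h f = f {#} \<odot>\<^bsub>B\<^esub> \<one>\<^bsub>B\<^esub>"
proof -
  interpret B: nc_algebra B by (rule B)
  have const: "(\<lambda>f. f {#} \<odot>\<^bsub>B\<^esub> \<one>\<^bsub>B\<^esub>) \<in> alg_hom (poly_algebra V) B"
    by (rule alg_homI)
       (simp_all add: poly_const_coeff B.smult_l_distr B.smult_smult B.smult_mult_l B.smult_mult_r,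
        simp_all add: poly_algebra_def B.smult_l_distr B.smult_smult basis_elem_def mult.commute)
  have "h (basis_elem m) = basis_elem m {#} \<odot>\<^bsub>B\<^esub> \<one>\<^bsub>B\<^esub>" if "set_mset m \<subseteq> V" for m
  proof (cases m)
    case empty
    then show ?thesis
      using alg_homD(4)[OF h] by (simp add: poly_algebra_def) (simp add: basis_elem_def)
  next
    case (add v m')
    have "basis_elem m = (poly_var v \<otimes>\<^bsub>poly_algebra V\<^esub> basis_elem m' :: 'v multiset \<Rightarrow> 'k)"
      by (simp add: poly_algebra_def poly_var_def conv_basis_elem add)
    moreover have "(basis_elem m' :: 'v multiset \<Rightarrow> 'k) \<in> carrier (poly_algebra V)"
      "(poly_var v :: 'v multiset \<Rightarrow> 'k) \<in> carrier (poly_algebra V)"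
      using that add by (auto simp: poly_algebra_def poly_var_def)
    ultimately have "h (basis_elem m) = \<zero>\<^bsub>B\<^esub>"
      using alg_homD(1,2)[OF h] zero[of v] that add by simp
    then show ?thesis by (simp add: basis_elem_def add)
  qed
  then have "h (basis_elem m) = basis_elem m {#} \<odot>\<^bsub>B\<^esub> \<one>\<^bsub>B\<^esub>" if "m \<in> carrier (mset_monoid V)" for m
    using that by simp
  then show ?thesis
    by (rule monoid_algebra_hom_unique[OF mset_monoid B
          h[unfolded poly_algebra_def] const[unfolded poly_algebra_def] _ f[unfolded poly_algebra_def]])
qed

section \<open>Pure tensors and homomorphisms on tensor products\<close>

locale tensor = A: nc_algebra A + B: nc_algebra B
  for A :: "('k::field, 'a) module" and B :: "('k, 'b) module"
begin

lemma prod_monoid: "monoid (A \<times>\<times> B)"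
  by (rule DirProd_monoid[OF A.monoid_axioms B.monoid_axioms])

abbreviation "MA \<equiv> monoid_algebra (A \<times>\<times> B) :: ('k, 'a \<times> 'b \<Rightarrow> 'k) module"

sublocale MA: nc_algebra MA
  by (rule monoid.monoid_algebra_nc_algebra[OF prod_monoid])

lemma basis_carrier [simp]: "a \<in> carrier A \<Longrightarrow> b \<in> carrier B \<Longrightarrow> basis_elem (a, b) \<in> carrier MA"
  by simp

sublocale relations MA "bilinear_relations A B"
proof (intro relations.intro relations_axioms.intro MA.nc_algebra_axioms)
  show "bilinear_relations A B \<subseteq> carrier MA \<times> carrier MA"
    unfolding bilinear_relations_def Let_def
    by (auto simp del: monoid_algebra_simps intro!: MA.add.m_closed MA.smult_closed basis_carrier)
qed

abbreviation "pure \<equiv> pure_tensor A B"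

lemma pure_closed [simp]:
  "a \<in> carrier A \<Longrightarrow> b \<in> carrier B \<Longrightarrow> pure a b \<in> carrier (tensor_algebra A B)"
  unfolding tensor_algebra_def pure_tensor_def by (intro cl.hom_simps basis_carrier)

lemma pure_mult:
  "a \<in> carrier A \<Longrightarrow> b \<in> carrier B \<Longrightarrow> a' \<in> carrier A \<Longrightarrow> b' \<in> carrier B \<Longrightarrow>
    pure (a \<otimes>\<^bsub>A\<^esub> a') (b \<otimes>\<^bsub>B\<^esub> b') = pure a b \<otimes>\<^bsub>tensor_algebra A B\<^esub> pure a' b'"
  unfolding tensor_algebra_def pure_tensor_def
  by (subst cl.hom_simps(2)[symmetric]) (simp_all add: conv_basis_elem)

lemma pure_one: "pure \<one>\<^bsub>A\<^esub> \<one>\<^bsub>B\<^esub> = \<one>\<^bsub>tensor_algebra A B\<^esub>"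
  unfolding tensor_algebra_def pure_tensor_def
  by (subst cl.hom_simps(4)[symmetric]) simp

lemma pure_add_left:
  assumes "a \<in> carrier A" "a' \<in> carrier A" "b \<in> carrier B"
  shows "pure (a \<oplus>\<^bsub>A\<^esub> a') b = pure a b \<oplus>\<^bsub>tensor_algebra A B\<^esub> pure a' b"
proof -
  have "(basis_elem (a \<oplus>\<^bsub>A\<^esub> a', b), basis_elem (a, b) \<oplus>\<^bsub>MA\<^esub> basis_elem (a', b)) \<in> bilinear_relations A B"
    unfolding bilinear_relations_def Let_def using assms by blast
  from rel_class_rel[OF this] show ?thesis
    using assms cl.hom_simps(3)[OF basis_carrier basis_carrier]
    by (simp only: pure_tensor_def tensor_algebra_def)
qed

lemma pure_add_right:
  assumes "a \<in> carrier A" "b \<in> carrier B" "b' \<in> carrier B"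
  shows "pure a (b \<oplus>\<^bsub>B\<^esub> b') = pure a b \<oplus>\<^bsub>tensor_algebra A B\<^esub> pure a b'"
proof -
  have "(basis_elem (a, b \<oplus>\<^bsub>B\<^esub> b'), basis_elem (a, b) \<oplus>\<^bsub>MA\<^esub> basis_elem (a, b')) \<in> bilinear_relations A B"
    unfolding bilinear_relations_def Let_def using assms by blast
  from rel_class_rel[OF this] show ?thesis
    using assms cl.hom_simps(3)[OF basis_carrier basis_carrier]
    by (simp only: pure_tensor_def tensor_algebra_def)
qed

lemma pure_smult_left:
  assumes "a \<in> carrier A" "b \<in> carrier B"
  shows "pure (c \<odot>\<^bsub>A\<^esub> a) b = c \<odot>\<^bsub>tensor_algebra A B\<^esub> pure a b"
proof -
  have "(basis_elem (c \<odot>\<^bsub>A\<^esub> a, b), c \<odot>\<^bsub>MA\<^esub> basis_elem (a, b)) \<in> bilinear_relations A B"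
    unfolding bilinear_relations_def Let_def using assms by blast
  from rel_class_rel[OF this] show ?thesis
    using assms cl.hom_simps(5)[OF basis_carrier]
    by (simp only: pure_tensor_def tensor_algebra_def)
qed

lemma pure_smult_right:
  assumes "a \<in> carrier A" "b \<in> carrier B"
  shows "pure a (c \<odot>\<^bsub>B\<^esub> b) = c \<odot>\<^bsub>tensor_algebra A B\<^esub> pure a b"
proof -
  have "(basis_elem (a, c \<odot>\<^bsub>B\<^esub> b), c \<odot>\<^bsub>MA\<^esub> basis_elem (a, b)) \<in> bilinear_relations A B"
    unfolding bilinear_relations_def Let_def using assms by blast
  from rel_class_rel[OF this] show ?thesis
    using assms cl.hom_simps(5)[OF basis_carrier]
    by (simp only: pure_tensor_def tensor_algebra_def)
qed

lemmas pure_bilinear = pure_add_left pure_add_right pure_smult_left pure_smult_right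

lemma pure_left_hom: "(\<lambda>a. pure a \<one>\<^bsub>B\<^esub>) \<in> alg_hom A (tensor_algebra A B)"
  using pure_mult[of _ "\<one>\<^bsub>B\<^esub>" _ "\<one>\<^bsub>B\<^esub>"] by (intro alg_homI) (auto simp: pure_bilinear pure_one)

lemma pure_right_hom: "(\<lambda>b. pure \<one>\<^bsub>A\<^esub> b) \<in> alg_hom B (tensor_algebra A B)"
  using pure_mult[of "\<one>\<^bsub>A\<^esub>" _ "\<one>\<^bsub>A\<^esub>"] by (intro alg_homI) (auto simp: pure_bilinear pure_one)

text \<open>Reduces the study of homomorphisms on the tensor product to their restrictions to the
  two factors.\<close>

lemma pure_split:
  "a \<in> carrier A \<Longrightarrow> b \<in> carrier B \<Longrightarrow> pure a b = pure a \<one>\<^bsub>B\<^esub> \<otimes>\<^bsub>tensor_algebra A B\<^esub> pure \<one>\<^bsub>A\<^esub> b"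
  using pure_mult[of a "\<one>\<^bsub>B\<^esub>" "\<one>\<^bsub>A\<^esub>" b] by simp

end

text \<open>The map (a, f) to f(0) a is multiplicative and bilinear, so its linear extension is
  constant on tensor classes. Hence the set of values over all representatives is a singleton and
  \<open>the_elem\<close> picks its member.\<close>

lemma set_vars_zero_rel_class:
  fixes A :: "('k::field, 'a) module" and V :: "'v set"
  assumes A: "nc_algebra A"
  defines "\<beta> \<equiv> \<lambda>u. (snd u {#} :: 'k) \<odot>\<^bsub>A\<^esub> fst u"
  defines "M \<equiv> A \<times>\<times> poly_algebra V :: ('a \<times> ('v multiset \<Rightarrow> 'k)) monoid"
  shows "mext A \<beta> \<in> alg_hom (monoid_algebra M) A"
    and "F \<in> carrier (monoid_algebra M) \<Longrightarrow>
      set_vars_zero A (rel_class (monoid_algebra M) (bilinear_relations A (poly_algebra V)) F) = mext A \<beta> F"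
proof -
  interpret A: nc_algebra A by (rule A)
  interpret P: nc_algebra "poly_algebra V :: ('k, 'v multiset \<Rightarrow> 'k) module"
    by (rule poly_algebra_nc_algebra)
  interpret tensor A "poly_algebra V" ..
  have add0: "(f \<oplus>\<^bsub>poly_algebra V\<^esub> g) {#} = f {#} + (g {#} :: 'k)" for f g
    by (simp add: poly_algebra_def)
  have smult0: "(c \<odot>\<^bsub>poly_algebra V\<^esub> f) {#} = c * (f {#} :: 'k)" for f c
    by (simp add: poly_algebra_def)
  have one0: "\<one>\<^bsub>poly_algebra V\<^esub> {#} = (1 :: 'k)"
    by (simp add: poly_algebra_def basis_elem_def)
  interpret monoid_rep M A \<beta>
    unfolding M_def \<beta>_def
    by (intro monoid_rep.intro monoid_rep_axioms.intro prod_monoid A)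
       (auto simp: poly_const_coeff A.smult_mult_l A.smult_mult_r A.smult_smult one0 mult.commute)
  interpret h: alg_hom_pair MA A "mext A \<beta>"
    using mext_hom A MA.nc_algebra_axioms unfolding M_def by (intro alg_hom_pairI)
  have val: "mext A \<beta> (basis_elem (a, f)) = f {#} \<odot>\<^bsub>A\<^esub> a"
    if "a \<in> carrier A" "f \<in> carrier (poly_algebra V)" for a f
    using that mext_basis_elem[of "(a, f)"] by (simp add: M_def \<beta>_def)
  show "mext A \<beta> \<in> alg_hom (monoid_algebra M) A" by (rule mext_hom)
  show "set_vars_zero A (rel_class (monoid_algebra M) (bilinear_relations A (poly_algebra V)) F) = mext A \<beta> F"
    if F: "F \<in> carrier (monoid_algebra M)"
  proof -
    let ?X = "rel_class MA (bilinear_relations A (poly_algebra V)) F"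
    interpret I: ideal relI MA by (rule rel_ideal)
    have FM: "F \<in> carrier MA" using F by (simp only: M_def)
    have kills: "mext A \<beta> l = mext A \<beta> r" if "(l, r) \<in> bilinear_relations A (poly_algebra V)" for l r
      using that unfolding bilinear_relations_def Let_def
      by (auto simp: h.hom_simps val add0 smult0 A.smult_l_distr A.smult_r_distr A.smult_smult mult.commute
          simp del: monoid_algebra_simps)
    have const: "mext A \<beta> G = mext A \<beta> F" if "G \<in> ?X" for G
      by (rule rel_class_eqD[OF A h.hom kills FM that])
    have mem: "F \<in> ?X" using I.a_rcos_self[OF FM] by (simp add: rel_class_def)
    \<comment> \<open>Membership of all representatives in the carrier is what allows the two
      scalars \<open>G u\<close> and \<open>snd u {#}\<close> to be merged into one.\<close>
    have XM: "?X \<subseteq> carrier MA"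
    proof
      fix G assume "G \<in> ?X"
      then obtain i where "i \<in> relI" "G = i \<oplus>\<^bsub>MA\<^esub> F"
        by (auto simp: rel_class_def a_r_coset_def r_coset_def)
      then show "G \<in> carrier MA" using I.Icarr FM MA.add.m_closed by blast
    qed
    have "(\<Oplus>\<^bsub>A\<^esub>u\<in>supp G. (G u * snd u {#}) \<odot>\<^bsub>A\<^esub> fst u) = mext A \<beta> F" if "G \<in> ?X" for G
    proof -
      have "supp G \<subseteq> carrier A \<times> carrier (poly_algebra V)"
        using that XM by (auto simp: subset_iff)
      then have "mext A \<beta> G = (\<Oplus>\<^bsub>A\<^esub>u\<in>supp G. (G u * snd u {#}) \<odot>\<^bsub>A\<^esub> fst u)"
        unfolding mext_def \<beta>_def by (intro A.finsum_cong) (auto simp: A.smult_smult subset_iff)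
      with const[OF that] show ?thesis by simp
    qed
    then have "(\<lambda>G. \<Oplus>\<^bsub>A\<^esub>u\<in>supp G. (G u * snd u {#}) \<odot>\<^bsub>A\<^esub> fst u) ` ?X = {mext A \<beta> F}"
      using mem by auto
    then show ?thesis by (simp add: set_vars_zero_def M_def)
  qed
qed

text \<open>A homomorphism killing the variables factors through setting them to zero. It suffices
  to compare on pure tensors, where \<open>h\<close> takes the value p(a) f(0) by
  \<open>pure_split\<close> and \<open>poly_hom_eval_zero\<close>.\<close>

lemma tensor_hom_set_vars_zero:
  fixes A :: "('k::field, 'a) module" and V :: "'v set"
  assumes A: "nc_algebra A" and C: "nc_algebra C"
    and h: "h \<in> alg_hom (tensor_algebra A (poly_algebra V)) C"
    and p: "p \<in> alg_hom A C"
    and left: "\<And>a. a \<in> carrier A \<Longrightarrow> h (pure_tensor A (poly_algebra V) a \<one>\<^bsub>poly_algebra V\<^esub>) = p a"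
    and right: "\<And>v. v \<in> V \<Longrightarrow> h (pure_tensor A (poly_algebra V) \<one>\<^bsub>A\<^esub> (poly_var v)) = \<zero>\<^bsub>C\<^esub>"
    and X: "X \<in> carrier (tensor_algebra A (poly_algebra V))"
  shows "h X = p (set_vars_zero A X)"
proof -
  interpret tensor A "poly_algebra V"
    using A poly_algebra_nc_algebra by (rule tensor.intro)
  let ?\<beta> = "\<lambda>u. (snd u {#} :: 'k) \<odot>\<^bsub>A\<^esub> fst u"
  interpret p: alg_hom_pair A C p using A C p by (rule alg_hom_pairI)
  note svz = set_vars_zero_rel_class[OF A, where V = V]
  interpret m: alg_hom_pair MA A "mext A ?\<beta>"
    using MA.nc_algebra_axioms A svz(1) by (rule alg_hom_pairI)
  obtain F where F: "F \<in> carrier MA" "X = rel_class MA (bilinear_relations A (poly_algebra V)) F"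
    using X rel_class_surj by (auto simp: tensor_algebra_def)
  have right': "h (pure \<one>\<^bsub>A\<^esub> f) = f {#} \<odot>\<^bsub>C\<^esub> \<one>\<^bsub>C\<^esub>" if "f \<in> carrier (poly_algebra V)" for f
    using poly_hom_eval_zero[OF C alg_hom_comp[OF pure_right_hom h]] right that by simp
  have "(h \<circ> rel_class MA (bilinear_relations A (poly_algebra V))) F = (p \<circ> mext A ?\<beta>) F"
  proof (rule monoid_algebra_hom_unique[OF prod_monoid C _ _ _ F(1)])
    show "h \<circ> rel_class MA (bilinear_relations A (poly_algebra V)) \<in> alg_hom MA C"
      by (rule alg_hom_comp[OF rel_class_hom]) (use h in \<open>simp add: tensor_algebra_def\<close>)
    show "p \<circ> mext A ?\<beta> \<in> alg_hom MA C"
      by (rule alg_hom_comp[OF m.hom p])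
    fix u assume "u \<in> carrier (A \<times>\<times> (poly_algebra V :: ('k, 'v multiset \<Rightarrow> 'k) module))"
    then obtain a f where u: "u = (a, f)" and a: "a \<in> carrier A" and f: "f \<in> carrier (poly_algebra V)"
      by auto
    have "h (pure a f) = h (pure a \<one>\<^bsub>poly_algebra V\<^esub>) \<otimes>\<^bsub>C\<^esub> h (pure \<one>\<^bsub>A\<^esub> f)"
      using a f pure_split[OF a f] alg_homD(2)[OF h] by simp
    also have "\<dots> = p (f {#} \<odot>\<^bsub>A\<^esub> a)"
      using a f by (simp add: left right' p.B.smult_mult_r)
    also have "f {#} \<odot>\<^bsub>A\<^esub> a = mext A ?\<beta> (basis_elem (a, f))"
      using a by (simp add: mext_def) (simp add: basis_elem_def)
    finally show "(h \<circ> rel_class MA (bilinear_relations A (poly_algebra V))) (basis_elem u) =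
        (p \<circ> mext A ?\<beta>) (basis_elem u)"
      by (simp add: pure_tensor_def u)
  qed
  then show ?thesis using F svz(2) by simp
qed

section \<open>Power series over an algebra\<close>

context nc_algebra
begin

abbreviation "PS \<equiv> series_algebra A"

text \<open>The series c(t) a with a scalar series c and a fixed element a. All images of generating
  functions are finite sums of these, so calculations move to commutative scalar series.\<close>

definition ser :: "'k fps \<Rightarrow> 'a \<Rightarrow> nat \<Rightarrow> 'a" where
  "ser c a = (\<lambda>n. fps_nth c n \<odot> a)"

lemma ser_nth [simp]: "ser c a n = fps_nth c n \<odot> a"
  by (simp add: ser_def)

lemma ser_closed [simp, intro]: "a \<in> carrier A \<Longrightarrow> ser c a \<in> carrier PS"
  by (simp add: series_algebra_def)

lemma PS_nth_closed: "f \<in> carrier PS \<Longrightarrow> f n \<in> carrier A"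
  by (auto simp: series_algebra_def)

lemma PS_add_closed [simp, intro]: "f \<in> carrier PS \<Longrightarrow> g \<in> carrier PS \<Longrightarrow> f \<oplus>\<^bsub>PS\<^esub> g \<in> carrier PS"
  by (auto simp: series_algebra_def)

lemma PS_mult_closed [simp, intro]: "f \<in> carrier PS \<Longrightarrow> g \<in> carrier PS \<Longrightarrow> f \<otimes>\<^bsub>PS\<^esub> g \<in> carrier PS"
  by (auto simp: series_algebra_def Pi_iff)

lemma PS_smult_closed [simp, intro]: "f \<in> carrier PS \<Longrightarrow> c \<odot>\<^bsub>PS\<^esub> f \<in> carrier PS"
  by (auto simp: series_algebra_def Pi_iff)

lemma PS_subst_closed [simp, intro]: "f \<in> carrier PS \<Longrightarrow> series_subst A f s \<in> carrier PS"
  by (auto simp: series_algebra_def series_subst_def Pi_iff)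

lemma PS_abelian_group: "abelian_group PS"
proof (rule abelian_groupI)
  show "\<exists>g\<in>carrier PS. g \<oplus>\<^bsub>PS\<^esub> f = \<zero>\<^bsub>PS\<^esub>" if "f \<in> carrier PS" for f
    using that by (intro bexI[of _ "\<lambda>n. \<ominus> f n"]) (auto simp: series_algebra_def l_neg Pi_iff)
qed (auto simp: series_algebra_def a_ac Pi_iff)

lemma PS_add_nth: "(f \<oplus>\<^bsub>PS\<^esub> g) n = f n \<oplus> g n"
  by (simp add: series_algebra_def)

lemma PS_smult_nth: "(c \<odot>\<^bsub>PS\<^esub> f) n = (\<Oplus>i\<in>{..n}. fps_nth c i \<odot> f (n - i))"
  by (simp add: series_algebra_def)

lemma PS_mult_nth: "(f \<otimes>\<^bsub>PS\<^esub> g) n = (\<Oplus>i\<in>{..n}. f i \<otimes> g (n - i))"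
  by (simp add: series_algebra_def)

lemma PS_minus_closed [simp, intro]: "f \<in> carrier PS \<Longrightarrow> g \<in> carrier PS \<Longrightarrow> f \<ominus>\<^bsub>PS\<^esub> g \<in> carrier PS"
  using abelian_group.minus_closed[OF PS_abelian_group] .

text \<open>Negation in a ring record is defined by a description, so its coefficientwise form comes
  from uniqueness of additive inverses.\<close>

lemma PS_minus_nth:
  assumes f: "f \<in> carrier PS" and g: "g \<in> carrier PS" shows "(f \<ominus>\<^bsub>PS\<^esub> g) n = f n \<ominus> g n"
proof -
  interpret P: abelian_group PS by (rule PS_abelian_group)
  have "(\<lambda>n. \<ominus> g n) \<oplus>\<^bsub>PS\<^esub> g = \<zero>\<^bsub>PS\<^esub>" "(\<lambda>n. \<ominus> g n) \<in> carrier PS"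
    using g by (auto simp: series_algebra_def l_neg Pi_iff)
  then have "\<ominus>\<^bsub>PS\<^esub> g = (\<lambda>n. \<ominus> g n)"
    using P.minus_equality g by blast
  then show ?thesis by (simp add: a_minus_def PS_add_nth)
qed

lemma PS_one: "\<one>\<^bsub>PS\<^esub> = ser 1 \<one>"
  by (auto simp: series_algebra_def fun_eq_iff)

lemma series_const_eq_ser: "a \<in> carrier A \<Longrightarrow> series_const A a = ser 1 a"
  by (auto simp: series_const_def fun_eq_iff)

lemma smult_ser: "a \<in> carrier A \<Longrightarrow> d \<odot>\<^bsub>PS\<^esub> ser c a = ser (d * c) a"
  by (simp add: fun_eq_iff PS_smult_nth smult_smult finsum_smult fps_mult_nth atMost_atLeast0)

text \<open>The scalar coefficients move out of each product, leaving the Cauchy product of c and d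
  in front of one fixed element.\<close>

lemma mult_ser:
  "a \<in> carrier A \<Longrightarrow> b \<in> carrier A \<Longrightarrow> ser c a \<otimes>\<^bsub>PS\<^esub> ser d b = ser (c * d) (a \<otimes> b)"
  by (simp add: fun_eq_iff PS_mult_nth smult_smult smult_mult_l smult_mult_r finsum_smult
      fps_mult_nth atMost_atLeast0 mult.commute)

lemma subst_ser: "a \<in> carrier A \<Longrightarrow> series_subst A (ser c a) s = ser (fps_compose c s) a"
  by (simp add: fun_eq_iff series_subst_def smult_smult finsum_smult fps_compose_nth
      atMost_atLeast0 mult.commute)

lemma smult_PS_add:
  assumes "f \<in> carrier PS" "g \<in> carrier PS"
  shows "c \<odot>\<^bsub>PS\<^esub> (f \<oplus>\<^bsub>PS\<^esub> g) = c \<odot>\<^bsub>PS\<^esub> f \<oplus>\<^bsub>PS\<^esub> c \<odot>\<^bsub>PS\<^esub> g"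
  using PS_nth_closed[OF assms(1)] PS_nth_closed[OF assms(2)]
  by (simp add: fun_eq_iff PS_add_nth PS_smult_nth smult_r_distr finsum_addf Pi_iff)

lemma mult_PS_add_left:
  assumes "f \<in> carrier PS" "g \<in> carrier PS" "h \<in> carrier PS"
  shows "(f \<oplus>\<^bsub>PS\<^esub> g) \<otimes>\<^bsub>PS\<^esub> h = f \<otimes>\<^bsub>PS\<^esub> h \<oplus>\<^bsub>PS\<^esub> g \<otimes>\<^bsub>PS\<^esub> h"
  using PS_nth_closed[OF assms(1)] PS_nth_closed[OF assms(2)] PS_nth_closed[OF assms(3)]
  by (simp add: fun_eq_iff PS_add_nth PS_mult_nth l_distr finsum_addf Pi_iff)

lemma mult_PS_add_right:
  assumes "f \<in> carrier PS" "g \<in> carrier PS" "h \<in> carrier PS"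
  shows "h \<otimes>\<^bsub>PS\<^esub> (f \<oplus>\<^bsub>PS\<^esub> g) = h \<otimes>\<^bsub>PS\<^esub> f \<oplus>\<^bsub>PS\<^esub> h \<otimes>\<^bsub>PS\<^esub> g"
  using PS_nth_closed[OF assms(1)] PS_nth_closed[OF assms(2)] PS_nth_closed[OF assms(3)]
  by (simp add: fun_eq_iff PS_add_nth PS_mult_nth r_distr finsum_addf Pi_iff)

lemma subst_PS_add:
  assumes "f \<in> carrier PS" "g \<in> carrier PS"
  shows "series_subst A (f \<oplus>\<^bsub>PS\<^esub> g) s = series_subst A f s \<oplus>\<^bsub>PS\<^esub> series_subst A g s"
  using PS_nth_closed[OF assms(1)] PS_nth_closed[OF assms(2)]
  by (simp add: fun_eq_iff PS_add_nth series_subst_def smult_r_distr finsum_addf Pi_iff)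

end

section \<open>Homomorphisms applied coefficientwise to power series\<close>

context alg_hom_pair
begin

lemma hom_PS_add:
  "f \<in> carrier A.PS \<Longrightarrow> g \<in> carrier A.PS \<Longrightarrow> h \<circ> (f \<oplus>\<^bsub>A.PS\<^esub> g) = (h \<circ> f) \<oplus>\<^bsub>B.PS\<^esub> (h \<circ> g)"
  by (simp add: fun_eq_iff A.PS_add_nth B.PS_add_nth A.PS_nth_closed)

lemma hom_PS_minus:
  assumes "f \<in> carrier A.PS" "g \<in> carrier A.PS"
  shows "h \<circ> (f \<ominus>\<^bsub>A.PS\<^esub> g) = (h \<circ> f) \<ominus>\<^bsub>B.PS\<^esub> (h \<circ> g)"
proof -
  have "h \<circ> f \<in> carrier B.PS" "h \<circ> g \<in> carrier B.PS"
    using assms by (auto simp: series_algebra_def Pi_iff)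
  with assms show ?thesis
    by (simp add: fun_eq_iff A.PS_minus_nth B.PS_minus_nth A.PS_nth_closed)
qed

lemma hom_PS_mult:
  "f \<in> carrier A.PS \<Longrightarrow> g \<in> carrier A.PS \<Longrightarrow> h \<circ> (f \<otimes>\<^bsub>A.PS\<^esub> g) = (h \<circ> f) \<otimes>\<^bsub>B.PS\<^esub> (h \<circ> g)"
  by (simp add: fun_eq_iff A.PS_mult_nth B.PS_mult_nth hom_finsum A.PS_nth_closed)

lemma hom_PS_smult:
  "f \<in> carrier A.PS \<Longrightarrow> h \<circ> (c \<odot>\<^bsub>A.PS\<^esub> f) = c \<odot>\<^bsub>B.PS\<^esub> (h \<circ> f)"
  by (simp add: fun_eq_iff A.PS_smult_nth B.PS_smult_nth hom_finsum A.PS_nth_closed)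

lemma hom_series_subst:
  "f \<in> carrier A.PS \<Longrightarrow> h \<circ> series_subst A f s = series_subst B (h \<circ> f) s"
  by (simp add: fun_eq_iff series_subst_def hom_finsum A.PS_nth_closed)

lemma hom_G_series: "h \<circ> G_series q A g = G_series q B (h \<circ> g)"
  by (auto simp: fun_eq_iff G_series_def split: nat.split)

end

section \<open>Relations in the quantum torus\<close>

context nc_algebra
begin

lemma commutator_closed [simp]: "a \<in> carrier A \<Longrightarrow> b \<in> carrier A \<Longrightarrow> commutator A a b \<in> carrier A"
  by (simp add: commutator_def)

lemma q_commutator_closed [simp]: "a \<in> carrier A \<Longrightarrow> b \<in> carrier A \<Longrightarrow> q_commutator A r a b \<in> carrier A"
  by (simp add: q_commutator_def)

lemma commutator_self: "a \<in> carrier A \<Longrightarrow> commutator A a a = \<zero>"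
  by (simp add: commutator_def a_minus_def r_neg)

lemma commutator_swap: "a \<in> carrier A \<Longrightarrow> b \<in> carrier A \<Longrightarrow> commutator A b a = (- 1) \<odot> commutator A a b"
  by (simp add: commutator_def smult_diff_r flip: smult_minus)
     (simp add: a_minus_def a_comm)

lemma commutator_smult:
  "a \<in> carrier A \<Longrightarrow> b \<in> carrier A \<Longrightarrow> commutator A (c \<odot> a) (d \<odot> b) = (c * d) \<odot> commutator A a b"
  by (simp add: commutator_def smult_mult_l smult_mult_r smult_smult smult_diff_r mult.commute)

lemma minus_add_cancel_right:
  "a \<in> carrier A \<Longrightarrow> b \<in> carrier A \<Longrightarrow> c \<in> carrier A \<Longrightarrow> (a \<oplus> c) \<ominus> (b \<oplus> c) = a \<ominus> b"
  by (simp add: a_minus_def minus_add a_ac) (metis a_lcomm add.inv_closed r_neg r_zero)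

text \<open>Multiples of 1 are central and drop out. The three shapes are those in which the images
  of the G generators, a multiple of one element plus a scalar, meet each other and the images of
  the W generators.\<close>

lemma commutator_smult_add_one:
  assumes "a \<in> carrier A" "b \<in> carrier A"
  shows "commutator A (c \<odot> a \<oplus> d \<odot> \<one>) (e \<odot> b \<oplus> f \<odot> \<one>) = (c * e) \<odot> commutator A a b"
    and "commutator A (c \<odot> a) (e \<odot> b \<oplus> f \<odot> \<one>) = (c * e) \<odot> commutator A a b"
    and "commutator A (c \<odot> a \<oplus> d \<odot> \<one>) (e \<odot> b) = (c * e) \<odot> commutator A a b"
proof -
  have one: "commutator A u (v \<oplus> f \<odot> \<one>) = commutator A u v"
    if "u \<in> carrier A" "v \<in> carrier A" for u v f
    using that by (simp add: commutator_def l_distr r_distr smult_mult_l smult_mult_r minus_add_cancel_right)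
  have one': "commutator A (u \<oplus> f \<odot> \<one>) v = commutator A u v"
    if "u \<in> carrier A" "v \<in> carrier A" for u v f
    using that by (simp add: commutator_def l_distr r_distr smult_mult_l smult_mult_r minus_add_cancel_right)
  show "commutator A (c \<odot> a \<oplus> d \<odot> \<one>) (e \<odot> b \<oplus> f \<odot> \<one>) = (c * e) \<odot> commutator A a b"
    and "commutator A (c \<odot> a) (e \<odot> b \<oplus> f \<odot> \<one>) = (c * e) \<odot> commutator A a b"
    and "commutator A (c \<odot> a \<oplus> d \<odot> \<one>) (e \<odot> b) = (c * e) \<odot> commutator A a b"
    using assms by (simp_all add: one one' commutator_smult)
qed

text \<open>Unlike the commutator, the \<open>q\<close>-commutator of a with 1 survives: it equals
  (r - 1/r) a in either order.\<close>

lemma q_commutator_smult_add_one: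
  assumes "a \<in> carrier A" "b \<in> carrier A"
  shows "q_commutator A r a (e \<odot> b \<oplus> f \<odot> \<one>) =
      e \<odot> q_commutator A r a b \<oplus> (f * (r - inverse r)) \<odot> a" (is ?A)
    and "q_commutator A r (e \<odot> b \<oplus> f \<odot> \<one>) a =
      e \<odot> q_commutator A r b a \<oplus> (f * (r - inverse r)) \<odot> a" (is ?B)
proof -
  have [simp]: "(u \<oplus> v) \<ominus> (u' \<oplus> v') = (u \<ominus> u') \<oplus> (v \<ominus> v')"
    if "u \<in> carrier A" "v \<in> carrier A" "u' \<in> carrier A" "v' \<in> carrier A" for u v u' v'
    using that by (simp add: a_minus_def minus_add a_ac)
  show ?A ?B
    using assms
    by (simp_all add: q_commutator_def l_distr r_distr smult_mult_l smult_mult_r smult_r_distr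
        smult_smult smult_diff_r smult_diff_l algebra_simps)
qed

lemma q_cancel: "q \<noteq> 0 \<Longrightarrow> q * (inverse q * z) = z" "q \<noteq> 0 \<Longrightarrow> inverse q * (q * z) = z" for q z :: 'k
  by (simp_all flip: mult.assoc)

text \<open>Scaling u v by q and v u by 1/q gives M the same coefficient q^2 in both, so M cancels
  and only P remains. In each use P is X or Y and M collects the two remaining monomials.\<close>

lemma q_commutator_split:
  assumes "u \<in> carrier A" "v \<in> carrier A" "P \<in> carrier A" "M \<in> carrier A" "q \<noteq> 0"
    and uv: "u \<otimes> v = q \<odot> P \<oplus> q \<odot> M" and vu: "v \<otimes> u = inverse q \<odot> P \<oplus> (q ^ 3) \<odot> M"
  shows "q_commutator A q u v = (q\<^sup>2 - inverse q ^ 2) \<odot> P"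
proof -
  have "q_commutator A q u v = (q\<^sup>2 \<odot> P \<oplus> q\<^sup>2 \<odot> M) \<ominus> ((inverse q ^ 2) \<odot> P \<oplus> q\<^sup>2 \<odot> M)"
    unfolding q_commutator_def uv vu using assms(1-5)
    by (simp add: smult_r_distr smult_smult power2_eq_square power3_eq_cube mult.assoc q_cancel)
  also have "\<dots> = (q\<^sup>2 - inverse q ^ 2) \<odot> P"
    using assms(1-5) by (simp add: minus_add_cancel_right smult_diff_l)
  finally show ?thesis .
qed

end

text \<open>Formulated for any four elements satisfying the torus relations, so the calculations run
  on short names; the main proof interprets it in \<open>quantum_torus q\<close>.\<close>

locale torus = nc_algebra A for A :: "('k::field_char_0, 'a) module" (structure) +
  fixes q :: 'k and x x' y y' :: 'a
  assumes q [simp]: "q \<noteq> 0"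
    and closed [simp]: "x \<in> carrier A" "x' \<in> carrier A" "y \<in> carrier A" "y' \<in> carrier A"
    and xx' [simp]: "x \<otimes> x' = \<one>" and x'x [simp]: "x' \<otimes> x = \<one>"
    and yy' [simp]: "y \<otimes> y' = \<one>" and y'y [simp]: "y' \<otimes> y = \<one>"
    and xy: "x \<otimes> y = q\<^sup>2 \<odot> (y \<otimes> x)"
begin

abbreviation "c \<equiv> q + inverse q"

section \<open>Normal ordering and the identities between \<open>X\<close>, \<open>Y\<close>,
  \<open>E\<close>, \<open>F\<close>\<close>

definition "X = x \<oplus> x'"
definition "Y = y \<oplus> y'"
definition "E = q \<odot> (x' \<otimes> y) \<oplus> q \<odot> (x \<otimes> y')"
definition "F = inverse q \<odot> (x \<otimes> y) \<oplus> inverse q \<odot> (x' \<otimes> y')"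

lemma XYEF_closed [simp]: "X \<in> carrier A" "Y \<in> carrier A" "E \<in> carrier A" "F \<in> carrier A"
  by (simp_all add: X_def Y_def E_def F_def)

lemma cancel [simp]:
  "a \<in> carrier A \<Longrightarrow> x \<otimes> (x' \<otimes> a) = a" "a \<in> carrier A \<Longrightarrow> x' \<otimes> (x \<otimes> a) = a"
  "a \<in> carrier A \<Longrightarrow> y \<otimes> (y' \<otimes> a) = a" "a \<in> carrier A \<Longrightarrow> y' \<otimes> (y \<otimes> a) = a"
  by (simp_all flip: m_assoc)

lemma yx: "y \<otimes> x = (inverse q ^ 2) \<odot> (x \<otimes> y)"
  by (simp add: xy smult_smult flip: power_mult_distrib)

text \<open>Obtained by multiplying x y = q^2 y x by x' on both sides; the exchange rules for y'
  arise in the same way.\<close>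

lemma yx': "y \<otimes> x' = q\<^sup>2 \<odot> (x' \<otimes> y)"
proof -
  have "x' \<otimes> (x \<otimes> y) \<otimes> x' = q\<^sup>2 \<odot> (x' \<otimes> (y \<otimes> x) \<otimes> x')"
    by (simp add: xy smult_mult_l smult_mult_r)
  then show ?thesis by (simp add: m_assoc)
qed

lemma y'x: "y' \<otimes> x = q\<^sup>2 \<odot> (x \<otimes> y')"
proof -
  have "y' \<otimes> (x \<otimes> y) \<otimes> y' = q\<^sup>2 \<odot> (y' \<otimes> (y \<otimes> x) \<otimes> y')"
    by (simp add: xy smult_mult_l smult_mult_r)
  then show ?thesis by (simp add: m_assoc)
qed

lemma y'x': "y' \<otimes> x' = (inverse q ^ 2) \<odot> (x' \<otimes> y')"
proof -
  have "x' \<otimes> (y' \<otimes> x) \<otimes> x' = q\<^sup>2 \<odot> (x' \<otimes> (x \<otimes> y') \<otimes> x')"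
    by (simp add: y'x smult_mult_l smult_mult_r)
  then have "x' \<otimes> y' = q\<^sup>2 \<odot> (y' \<otimes> x')" by (simp add: m_assoc)
  then show ?thesis by (simp add: smult_smult flip: power_mult_distrib)
qed

text \<open>The exchange rules again, in the form that applies inside right-nested products.\<close>

lemma move:
  assumes "a \<in> carrier A"
  shows "y \<otimes> (x \<otimes> a) = (inverse q ^ 2) \<odot> (x \<otimes> (y \<otimes> a))"
    "y \<otimes> (x' \<otimes> a) = q\<^sup>2 \<odot> (x' \<otimes> (y \<otimes> a))"
    "y' \<otimes> (x \<otimes> a) = q\<^sup>2 \<odot> (x \<otimes> (y' \<otimes> a))"
    "y' \<otimes> (x' \<otimes> a) = (inverse q ^ 2) \<odot> (x' \<otimes> (y' \<otimes> a))"
  using assms by (simp_all add: yx yx' y'x y'x' smult_mult_l flip: m_assoc)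

text \<open>Rewrites any expression into a sum of scaled monomials with x, x' to the left of y,
  y'.\<close>

lemmas normalize = X_def Y_def E_def F_def l_distr r_distr smult_mult_l smult_mult_r smult_r_distr
  smult_smult m_assoc yx yx' y'x y'x' move

lemma XY: "X \<otimes> Y = q \<odot> F \<oplus> inverse q \<odot> E"
  by (simp add: normalize) (simp add: a_ac)

lemma YX: "Y \<otimes> X = q \<odot> E \<oplus> inverse q \<odot> F"
  by (simp add: normalize mult.assoc q_cancel power2_eq_square) (simp add: a_ac)

lemma X_E: "q_commutator A q X E = (q\<^sup>2 - inverse q ^ 2) \<odot> Y"
  by (rule q_commutator_split[where M = "x \<otimes> (x \<otimes> y') \<oplus> x' \<otimes> (x' \<otimes> y)"])
     (simp_all add: normalize mult.assoc q_cancel power2_eq_square power3_eq_cube a_ac)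

text \<open>Normal ordering gives the mixed monomials the coefficient q^-3 in F X and q^-1 in X F.
  The factor q^-4 in M turns these into the q and q^3 demanded by
  \<open>q_commutator_split\<close>.\<close>

lemma F_X: "q_commutator A q F X = (q\<^sup>2 - inverse q ^ 2) \<odot> Y"
  by (rule q_commutator_split[where
        M = "(inverse q ^ 4) \<odot> (x \<otimes> (x \<otimes> y)) \<oplus> (inverse q ^ 4) \<odot> (x' \<otimes> (x' \<otimes> y'))"])
     (simp_all add: normalize mult.assoc q_cancel power2_eq_square power3_eq_cube power4_eq_xxxx a_ac)

lemma E_Y: "q_commutator A q E Y = (q\<^sup>2 - inverse q ^ 2) \<odot> X"
  by (rule q_commutator_split[where M = "x' \<otimes> (y \<otimes> y) \<oplus> x \<otimes> (y' \<otimes> y')"])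
     (simp_all add: normalize mult.assoc q_cancel power2_eq_square power3_eq_cube a_ac)

lemma Y_F: "q_commutator A q Y F = (q\<^sup>2 - inverse q ^ 2) \<odot> X"
  by (rule q_commutator_split[where
        M = "(inverse q ^ 4) \<odot> (x \<otimes> (y \<otimes> y)) \<oplus> (inverse q ^ 4) \<odot> (x' \<otimes> (y' \<otimes> y'))"])
     (simp_all add: normalize mult.assoc q_cancel power2_eq_square power3_eq_cube power4_eq_xxxx a_ac)

lemma commutator_X_Y: "commutator A X Y = (q - inverse q) \<odot> (F \<ominus> E)"
proof -
  have "commutator A X Y = (q \<odot> F \<ominus> inverse q \<odot> F) \<ominus> (q \<odot> E \<ominus> inverse q \<odot> E)"
    unfolding commutator_def XY YX by (simp add: a_minus_def minus_add a_ac)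
  then show ?thesis by (simp add: smult_diff_l smult_diff_r)
qed

text \<open>In normal order E F contains only squares of x, x', y, y'. Completing them to X^2 and
  Y^2 adds a constant 2 each, which the last term removes.\<close>

lemma EF: "E \<otimes> F = (q\<^sup>2 \<odot> (X \<otimes> X) \<oplus> (inverse q ^ 2) \<odot> (Y \<otimes> Y)) \<oplus> (- 2 * (q\<^sup>2 + inverse q ^ 2)) \<odot> \<one>"
proof -
  have two: "\<one> \<oplus> \<one> = 2 \<odot> \<one>" using smult_l_distr[of \<one> 1 1] by simp
  have XX: "X \<otimes> X = (x \<otimes> x \<oplus> x' \<otimes> x') \<oplus> 2 \<odot> \<one>"
    by (simp add: normalize flip: two) (simp add: a_ac)
  have YY: "Y \<otimes> Y = (y \<otimes> y \<oplus> y' \<otimes> y') \<oplus> 2 \<odot> \<one>"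
    by (simp add: normalize flip: two) (simp add: a_ac)
  have cancel: "((a \<oplus> r \<odot> \<one>) \<oplus> (b \<oplus> s \<odot> \<one>)) \<oplus> t \<odot> \<one> = a \<oplus> b"
    if "a \<in> carrier A" "b \<in> carrier A" "r + s + t = 0" for a b r s t
  proof -
    have "((a \<oplus> r \<odot> \<one>) \<oplus> (b \<oplus> s \<odot> \<one>)) \<oplus> t \<odot> \<one> = (a \<oplus> b) \<oplus> (r \<odot> \<one> \<oplus> s \<odot> \<one> \<oplus> t \<odot> \<one>)"
      using that by (simp add: a_ac)
    also have "r \<odot> \<one> \<oplus> s \<odot> \<one> \<oplus> t \<odot> \<one> = (r + s + t) \<odot> \<one>"
      by (simp add: smult_l_distr)
    finally show ?thesis using that by simp
  qed
  have "E \<otimes> F = q\<^sup>2 \<odot> (x \<otimes> x \<oplus> x' \<otimes> x') \<oplus> (inverse q ^ 2) \<odot> (y \<otimes> y \<oplus> y' \<otimes> y')"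
    by (simp add: normalize mult.assoc q_cancel power2_eq_square) (simp add: a_ac)
  then show ?thesis
    unfolding XX YY by (simp add: smult_r_distr smult_smult cancel algebra_simps)
qed

end

section \<open>Scalar power series\<close>

text \<open>Two absorption identities combine to the claim multiplied by i + 1, which is then
  cancelled.\<close>

lemma central_binomial_Suc: "Suc i * (2 * Suc i choose Suc i) = 2 * (2 * i + 1) * (2 * i choose i)"
proof -
  have "Suc i * (Suc (Suc (2 * i)) choose Suc i) = Suc (Suc (2 * i)) * (Suc (2 * i) choose i)"
    using Suc_times_binomial_eq[of "Suc (2 * i)" i] by (simp only: mult.commute)
  moreover have "Suc i * (Suc (2 * i) choose i) = Suc (2 * i) * (2 * i choose i)"
    using Suc_times_binomial_eq[of "2 * i" i] binomial_symmetric[of i "Suc (2 * i)"]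
    by (simp add: Suc_diff_le mult_2 del: binomial_Suc_Suc)
  moreover have "Suc (Suc (2 * i)) = 2 * Suc i" "Suc (2 * i) = 2 * i + 1" by simp_all
  ultimately have "Suc i * (Suc i * (2 * Suc i choose Suc i)) = Suc i * (2 * (2 * i + 1) * (2 * i choose i))"
    by (metis mult.assoc mult.left_commute)
  then show ?thesis by (metis mult_left_cancel Suc_neq_Zero)
qed

section \<open>The series \<omega> and the closed form of its square\<close>

lemma omega_nth: "fps_nth (omega q) n =
    (if even n then of_nat (n choose (n div 2)) * inverse (q + inverse q) ^ n else 0)"
  by (simp add: omega_def)

lemma omega_0 [simp]: "fps_nth (omega q) 0 = 1"
  by (simp add: omega_nth)

text \<open>The coefficient form of the differential equation below. For odd n both sides vanish;
  for n = 2 i it is the recurrence of central binomial coefficients.\<close>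

lemma omega_recurrence:
  fixes q :: "'k::field_char_0"
  assumes "q + inverse q \<noteq> 0"
  shows "of_nat (Suc (Suc n)) * fps_nth (omega q) (Suc (Suc n)) * (q + inverse q)\<^sup>2 =
    4 * of_nat (Suc n) * fps_nth (omega q) n"
proof (cases "even n")
  case True
  then obtain i where n: "n = 2 * i" by blast
  let ?c = "inverse (q + inverse q)"
  have "Suc (Suc n) * (Suc (Suc n) choose Suc i) = 4 * Suc n * (n choose i)"
    using central_binomial_Suc[of i] by (simp add: n algebra_simps del: binomial_Suc_Suc)
  then have "(of_nat (Suc (Suc n) * (Suc (Suc n) choose Suc i)) :: 'k) = of_nat (4 * Suc n * (n choose i))"
    by (simp only:)
  then have *: "of_nat (Suc (Suc n)) * (of_nat (Suc (Suc n) choose Suc i) :: 'k) =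
      4 * of_nat (Suc n) * of_nat (n choose i)"
    by (simp only: of_nat_mult of_nat_numeral)
  have "inverse c ^ Suc (Suc n) * c\<^sup>2 = inverse c ^ n" if "c \<noteq> 0" for c :: 'k
    using that by (simp add: power2_eq_square field_simps)
  from this[OF assms] have "?c ^ Suc (Suc n) * (q + inverse q)\<^sup>2 = ?c ^ n" .
  then have "of_nat (Suc (Suc n)) * fps_nth (omega q) (Suc (Suc n)) * (q + inverse q)\<^sup>2 =
      of_nat (Suc (Suc n)) * of_nat (Suc (Suc n) choose Suc i) * ?c ^ n"
    by (simp add: omega_nth n del: of_nat_Suc)
  also have "\<dots> = 4 * of_nat (Suc n) * fps_nth (omega q) n"
    by (subst *) (simp add: omega_nth n)
  finally show ?thesis .
qed (simp add: omega_nth)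

lemma omega_deriv:
  fixes q :: "'k::field_char_0"
  assumes "q + inverse q \<noteq> 0"
  shows "fps_deriv (omega q) * (fps_const ((q + inverse q)\<^sup>2) - 4 * fps_X\<^sup>2) = 4 * fps_X * omega q"
proof (rule fps_ext)
  fix n
  have eq: "fps_deriv (omega q) * (fps_const ((q + inverse q)\<^sup>2) - 4 * fps_X\<^sup>2) =
      fps_const ((q + inverse q)\<^sup>2) * fps_deriv (omega q) - fps_const 4 * (fps_X\<^sup>2 * fps_deriv (omega q))"
    by (simp add: algebra_simps numeral_fps_const)
  have eq2: "4 * fps_X * omega q = fps_const 4 * (fps_X * omega q)"
    by (simp add: mult.assoc numeral_fps_const)
  show "fps_nth (fps_deriv (omega q) * (fps_const ((q + inverse q)\<^sup>2) - 4 * fps_X\<^sup>2)) n =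
      fps_nth (4 * fps_X * omega q) n"
  \<comment> \<open>Coefficient 0 says that \<omega> has no linear term; coefficient m + 1 is the
    recurrence at m.\<close>
  proof (cases n)
    case 0
    then show ?thesis unfolding eq eq2 by (simp add: omega_nth fps_X_power_mult_nth)
  next
    case (Suc m)
    then show ?thesis
      unfolding eq eq2 using omega_recurrence[OF assms, of m]
      by (cases m; simp add: fps_X_power_mult_nth; simp add: algebra_simps)
  qed
qed

text \<open>This identifies \<omega> with (1 - 4 t^2 / c^2)^(-1/2) for c = q + 1/q. By
  \<open>omega_deriv\<close> the derivative of the left side vanishes, so that side equals its
  constant term.\<close>

lemma omega_square:
  fixes q :: "'k::field_char_0"
  assumes c: "q + inverse q \<noteq> 0"
  shows "(omega q)\<^sup>2 * (fps_const ((q + inverse q)\<^sup>2) - 4 * fps_X\<^sup>2) = fps_const ((q + inverse q)\<^sup>2)"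
    (is "?F = _")
proof -
  let ?C = "fps_const ((q + inverse q)\<^sup>2) - 4 * fps_X\<^sup>2 :: 'k fps"
  have "fps_deriv ?C = - 8 * fps_X"
    by (simp add: fps_deriv_power numeral_fps_const power2_eq_square flip: fps_const_neg)
  then have "fps_deriv ?F = 2 * omega q * (fps_deriv (omega q) * ?C) - 8 * fps_X * (omega q)\<^sup>2"
    by (simp add: power2_eq_square algebra_simps)
  also have "\<dots> = 0"
    unfolding omega_deriv[OF c] by (simp add: power2_eq_square algebra_simps)
  finally have "?F = fps_const (fps_nth ?F 0)"
    by (simp only: fps_deriv_eq_0_iff)
  also have "fps_nth ?F 0 = (q + inverse q)\<^sup>2"
    by (simp add: power2_eq_square)
  finally show ?thesis .
qed

section \<open>The series S and T with denominators cleared\<close>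

lemma T_ser_eq:
  assumes "q \<noteq> 0"
  shows "T_ser q * (fps_const (inverse q) + fps_const q * fps_X\<^sup>2) = fps_const (q + inverse q) * fps_X"
proof (rule fps_ext)
  fix n
  have eq: "T_ser q * (fps_const (inverse q) + fps_const q * fps_X\<^sup>2) =
      fps_const (inverse q) * T_ser q + fps_const q * (fps_X\<^sup>2 * T_ser q)"
    by (simp add: algebra_simps)
  consider "n = 0" | "n = 1" | m where "n = Suc (Suc m)"
    by (metis One_nat_def not0_implies_Suc)
  then show "fps_nth (T_ser q * (fps_const (inverse q) + fps_const q * fps_X\<^sup>2)) n =
      fps_nth (fps_const (q + inverse q) * fps_X) n"
    unfolding eq using assms
    by cases (auto simp: T_ser_def fps_X_power_mult_nth field_simps)
qed

lemma S_ser_eq: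
  assumes "q \<noteq> 0"
  shows "S_ser q * (fps_const q + fps_const (inverse q) * fps_X\<^sup>2) = fps_const (q + inverse q) * fps_X"
  using T_ser_eq[of "inverse q"] assms by (simp add: S_ser_def add.commute)

lemma T_ser_0 [simp]: "fps_nth (T_ser q) 0 = 0"
  by (simp add: T_ser_def)

lemma S_ser_0 [simp]: "fps_nth (S_ser q) 0 = 0"
  by (simp add: S_ser_def)

text \<open>Since S T has no constant term, the shift loses nothing and really is division by
  t.\<close>

lemma X_shift_ST: "fps_X * fps_shift 1 (S_ser q * T_ser q) = S_ser q * T_ser q"
  by (rule fps_ext) (auto simp: neq0_conv)

lemma q_plus_inverse_nz:
  fixes q :: "'k::field"
  assumes "q \<noteq> 0" "q ^ 4 \<noteq> 1" shows "q + inverse q \<noteq> 0" "q\<^sup>2 - inverse q ^ 2 \<noteq> 0"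
proof -
  have *: "q\<^sup>2 - inverse q ^ 2 \<noteq> 0"
  proof
    assume "q\<^sup>2 - inverse q ^ 2 = 0"
    then have "q\<^sup>2 * q\<^sup>2 = 1" using assms(1) by (simp add: field_simps)
    then show False using assms(2) by (simp flip: power_add)
  qed
  then show "q\<^sup>2 - inverse q ^ 2 \<noteq> 0" .
  have "q\<^sup>2 - inverse q ^ 2 = (q - inverse q) * (q + inverse q)"
    by (simp add: power2_eq_square algebra_simps)
  with * show "q + inverse q \<noteq> 0" by auto
qed

text \<open>The left side is S T (q t + 1/(q t)), and T is by definition (q + 1/q) divided by that
  bracket. Multiplying by t first keeps everything a power series. This will make the coefficient of
  E vanish.\<close>

lemma shift_ST_S:
  assumes "q \<noteq> 0"
  shows "fps_const (inverse q) * fps_shift 1 (S_ser q * T_ser q) + fps_const q * (fps_X * S_ser q * T_ser q) =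
    fps_const (q + inverse q) * S_ser q" (is "?l = ?r")
proof -
  have "fps_X * ?l = fps_const (inverse q) * (fps_X * fps_shift 1 (S_ser q * T_ser q)) +
      fps_const q * (fps_X\<^sup>2 * S_ser q * T_ser q)"
    by (simp add: algebra_simps power2_eq_square)
  also have "\<dots> = S_ser q * (T_ser q * (fps_const (inverse q) + fps_const q * fps_X\<^sup>2))"
    unfolding X_shift_ST by (simp add: algebra_simps)
  also have "\<dots> = fps_X * ?r"
    unfolding T_ser_eq[OF assms] by (simp add: mult_ac)
  finally show ?thesis by simp
qed

text \<open>Exchanging q and 1/q exchanges S and T. This will make the coefficient of F
  vanish.\<close>

lemma shift_ST_T:
  assumes "q \<noteq> 0"
  shows "fps_const q * fps_shift 1 (S_ser q * T_ser q) + fps_const (inverse q) * (fps_X * S_ser q * T_ser q) =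
    fps_const (q + inverse q) * T_ser q"
  using shift_ST_S[of "inverse q"] assms by (simp add: S_ser_def ac_simps)

lemma omega_compose_square:
  fixes q :: "'k::field_char_0"
  assumes c: "q + inverse q \<noteq> 0" and s: "fps_nth s 0 = 0"
  shows "(fps_compose (omega q) s)\<^sup>2 * (fps_const ((q + inverse q)\<^sup>2) - 4 * s\<^sup>2) = fps_const ((q + inverse q)\<^sup>2)"
proof -
  have "fps_compose ((omega q)\<^sup>2 * (fps_const ((q + inverse q)\<^sup>2) - 4 * fps_X\<^sup>2)) s = fps_const ((q + inverse q)\<^sup>2)"
    unfolding omega_square[OF c] by simp
  then show ?thesis
    using s by (simp add: fps_compose_mult_distrib fps_compose_sub_distrib numeral_fps_const
        flip: fps_compose_power)
qed

text \<open>Here Q, R, X stand for q, 1/q, t. With u and v the denominators of S and T, one has S u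
  = T v = w, so multiplying by (u v)^2 leaves a polynomial identity in u, v, w.\<close>

lemma S_T_ring_identity:
  fixes Q R X S T :: "'a::idom"
  assumes QR: "Q * R = 1" and nz: "R + Q * X\<^sup>2 \<noteq> 0" "Q + R * X\<^sup>2 \<noteq> 0"
    and T: "T * (R + Q * X\<^sup>2) = (Q + R) * X" and S: "S * (Q + R * X\<^sup>2) = (Q + R) * X"
  shows "((Q + R)\<^sup>2 - 4 * S\<^sup>2) * ((Q + R)\<^sup>2 - 4 * T\<^sup>2) = ((Q + R)\<^sup>2 - 2 * (Q\<^sup>2 + R\<^sup>2) * (S * T))\<^sup>2"
proof -
  define u v C P w where "u = Q + R * X\<^sup>2" and "v = R + Q * X\<^sup>2" and "C = (Q + R)\<^sup>2"
    and "P = Q\<^sup>2 + R\<^sup>2" and "w = (Q + R) * X"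
  have u2: "u\<^sup>2 = Q\<^sup>2 + 2 * (Q * R) * X\<^sup>2 + R\<^sup>2 * (X\<^sup>2)\<^sup>2" and v2: "v\<^sup>2 = R\<^sup>2 + 2 * (Q * R) * X\<^sup>2 + Q\<^sup>2 * (X\<^sup>2)\<^sup>2"
    and uv: "u * v = (Q * R) + P * X\<^sup>2 + (Q * R) * (X\<^sup>2)\<^sup>2"
    by (simp_all add: u_def v_def P_def power2_eq_square algebra_simps)
  \<comment> \<open>The key relation between the denominators; with w^2 = C X^2 it completes the
    square, because 4 (P^2 - 4) w^4 + 16 w^4 = (2 P w^2)^2.\<close>
  have s: "u\<^sup>2 + v\<^sup>2 = P * (u * v) - (P\<^sup>2 - 4) * X\<^sup>2"
    unfolding u2 v2 uv QR P_def by (simp add: algebra_simps power2_eq_square)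
  have w2: "w\<^sup>2 = C * X\<^sup>2" by (simp add: w_def C_def power_mult_distrib)
  have "(C * u\<^sup>2 - 4 * W) * (C * v\<^sup>2 - 4 * W) = C\<^sup>2 * (u * v)\<^sup>2 - 4 * C * W * (u\<^sup>2 + v\<^sup>2) + 16 * W\<^sup>2"
    for W by (simp add: algebra_simps power2_eq_square)
  note this[of "w\<^sup>2"]
  also have "C\<^sup>2 * (u * v)\<^sup>2 - 4 * C * w\<^sup>2 * (u\<^sup>2 + v\<^sup>2) + 16 * (w\<^sup>2)\<^sup>2 = (C * (u * v) - 2 * P * w\<^sup>2)\<^sup>2"
    unfolding s w2 by (simp add: algebra_simps power2_eq_square)
  finally have *: "(C * u\<^sup>2 - 4 * w\<^sup>2) * (C * v\<^sup>2 - 4 * w\<^sup>2) = (C * (u * v) - 2 * P * w\<^sup>2)\<^sup>2" .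
  have "((C - 4 * S\<^sup>2) * (C - 4 * T\<^sup>2)) * (u * v)\<^sup>2 = (C * u\<^sup>2 - 4 * (S * u)\<^sup>2) * (C * v\<^sup>2 - 4 * (T * v)\<^sup>2)"
    by (simp add: algebra_simps power2_eq_square)
  also have "\<dots> = (C * (u * v) - 2 * P * ((S * u) * (T * v)))\<^sup>2"
    using * S T by (simp only: flip: u_def v_def w_def) (simp add: power2_eq_square)
  also have "\<dots> = (C - 2 * P * (S * T))\<^sup>2 * (u * v)\<^sup>2"
    by (simp add: algebra_simps power2_eq_square)
  finally show ?thesis
    using nz by (simp add: u_def v_def C_def P_def)
qed
lemma S_T_identity:
  fixes q :: "'k::field_char_0"
  assumes q: "q \<noteq> 0"
  shows "(fps_const ((q + inverse q)\<^sup>2) - 4 * (S_ser q)\<^sup>2) * (fps_const ((q + inverse q)\<^sup>2) - 4 * (T_ser q)\<^sup>2) =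
    (fps_const ((q + inverse q)\<^sup>2) - fps_const (2 * (q\<^sup>2 + inverse q ^ 2)) * (S_ser q * T_ser q))\<^sup>2"
proof -
  define Q R where "Q = fps_const q" and "R = fps_const (inverse q)"
  have "fps_nth (R + Q * fps_X\<^sup>2) 0 \<noteq> 0" "fps_nth (Q + R * fps_X\<^sup>2) 0 \<noteq> 0"
    using q by (simp_all add: Q_def R_def power2_eq_square)
  then have "R + Q * fps_X\<^sup>2 \<noteq> 0" "Q + R * fps_X\<^sup>2 \<noteq> 0" by (metis fps_zero_nth)+
  moreover have "Q * R = 1" using q by (simp add: Q_def R_def)
  moreover have "T_ser q * (R + Q * fps_X\<^sup>2) = (Q + R) * fps_X" "S_ser q * (Q + R * fps_X\<^sup>2) = (Q + R) * fps_X"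
    using T_ser_eq[OF q] S_ser_eq[OF q] by (simp_all add: Q_def R_def)
  ultimately have "((Q + R)\<^sup>2 - 4 * (S_ser q)\<^sup>2) * ((Q + R)\<^sup>2 - 4 * (T_ser q)\<^sup>2) =
      ((Q + R)\<^sup>2 - 2 * (Q\<^sup>2 + R\<^sup>2) * (S_ser q * T_ser q))\<^sup>2"
    by (intro S_T_ring_identity)
  then show ?thesis
    by (simp add: Q_def R_def numeral_fps_const fps_const_power)
qed

lemma omega_S_T:
  fixes q :: "'k::field_char_0"
  assumes q: "q \<noteq> 0" and c: "q + inverse q \<noteq> 0"
  shows "fps_compose (omega q) (S_ser q) * fps_compose (omega q) (T_ser q) *
      (fps_const ((q + inverse q)\<^sup>2) - fps_const (2 * (q\<^sup>2 + inverse q ^ 2)) * (S_ser q * T_ser q)) =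
    fps_const ((q + inverse q)\<^sup>2)" (is "?u * ?w * ?E = ?c")
proof -
  have "(?u * ?w * ?E)\<^sup>2 = ?u\<^sup>2 * ?w\<^sup>2 * ?E\<^sup>2" by (simp add: power_mult_distrib)
  also have "\<dots> = (?u\<^sup>2 * (?c - 4 * (S_ser q)\<^sup>2)) * (?w\<^sup>2 * (?c - 4 * (T_ser q)\<^sup>2))"
    unfolding S_T_identity[OF q, symmetric] by (simp only: mult_ac)
  also have "\<dots> = ?c\<^sup>2"
    by (simp only: omega_compose_square[OF c S_ser_0] omega_compose_square[OF c T_ser_0] power2_eq_square[of ?c])
  \<comment> \<open>Power series over a field form an integral domain, so equality of squares leaves
    only a sign, which the constant term decides in characteristic 0.\<close>
  finally have "?u * ?w * ?E = ?c \<or> ?u * ?w * ?E = - ?c" by (simp only: power2_eq_iff)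
  moreover have "?u * ?w * ?E \<noteq> - ?c"
  proof
    assume "?u * ?w * ?E = - ?c"
    then have "fps_nth (?u * ?w * ?E) 0 = fps_nth (- ?c) 0" by simp
    then have "(q + inverse q)\<^sup>2 = - ((q + inverse q)\<^sup>2)"
      by simp
    then show False using c by (simp add: eq_neg_iff_add_eq_0 flip: mult_2)
  qed
  ultimately show ?thesis by blast
qed

section \<open>The homomorphism from the alternating central extension\<close>

context torus
begin

abbreviation "lam \<equiv> q\<^sup>2 - inverse q ^ 2"
abbreviation "w k \<equiv> fps_nth (omega q) k"

text \<open>The coefficient of t^(k+1) in \<open>lam\<close> \<omega>(t) (t a - c); the index k
  belongs to the generator with subscript k + 1.\<close>

definition G_image :: "'a \<Rightarrow> nat \<Rightarrow> 'a" where
  "G_image a k = (lam * w k) \<odot> a \<oplus> (- (lam * c * w (Suc k))) \<odot> \<one>"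

fun alt_image :: "ace_gen \<Rightarrow> 'a" where
  "alt_image (Wneg k) = w k \<odot> X"
| "alt_image (Wpos k) = w k \<odot> Y"
| "alt_image (Gpl k) = G_image E k"
| "alt_image (Gtl k) = G_image F k"

lemma G_image_closed [simp]: "a \<in> carrier A \<Longrightarrow> G_image a k \<in> carrier A"
  by (simp add: G_image_def)

lemma alt_image_closed [simp]: "alt_image g \<in> carrier A"
  by (cases g) simp_all

section \<open>The images satisfy the relations of the central extension\<close>

lemma lam_factor: "lam = c * (q - inverse q)"
  by (simp add: power2_eq_square algebra_simps)

lemma smult_add_zero: "a \<in> carrier A \<Longrightarrow> r + s = 0 \<Longrightarrow> r \<odot> a \<oplus> s \<odot> a = \<zero>"
  by (simp flip: smult_l_distr)

text \<open>The scalar parts of the two images cancel in the difference, and \<open>lam\<close> / c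
  = q - 1/q is the factor in \<open>commutator_X_Y\<close>.\<close>

lemma relation_comm:
  assumes "c \<noteq> 0"
  shows "commutator A (w 0 \<odot> X) (w k \<odot> Y) = inverse c \<odot> (G_image F k \<ominus> G_image E k)"
    and "commutator A (w k \<odot> X) (w 0 \<odot> Y) = inverse c \<odot> (G_image F k \<ominus> G_image E k)"
proof -
  have "inverse c * (lam * w k) = w k * (q - inverse q)"
    unfolding lam_factor using assms by simp
  moreover have "inverse c \<odot> (G_image F k \<ominus> G_image E k) = (inverse c * (lam * w k)) \<odot> (F \<ominus> E)"
    by (simp add: G_image_def minus_add_cancel_right smult_diff_r smult_smult)
  ultimately have "inverse c \<odot> (G_image F k \<ominus> G_image E k) = (w k * (q - inverse q)) \<odot> (F \<ominus> E)"
    by (simp only:)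
  then show "commutator A (w 0 \<odot> X) (w k \<odot> Y) = inverse c \<odot> (G_image F k \<ominus> G_image E k)"
    and "commutator A (w k \<odot> X) (w 0 \<odot> Y) = inverse c \<odot> (G_image F k \<ominus> G_image E k)"
    \<comment> \<open>Keeping 1 as an explicit scalar lets \<open>commutator_smult\<close> also
      apply to the factor with w 0 = 1.\<close>
    by (simp_all add: commutator_smult commutator_X_Y smult_smult del: smult_1)
qed

text \<open>One computation for all four \<open>q\<close>-commutator families, with (U, V) being (X,
  Y) or (Y, X) and e being E or F. The scalar part of the image yields the multiple of U, the e part
  that of V.\<close>

lemma relation_q_comm:
  assumes "U \<in> carrier A" "V \<in> carrier A" "e \<in> carrier A"
  shows "q_commutator A q U e = lam \<odot> V \<Longrightarrow>
      q_commutator A q (w 0 \<odot> U) (G_image e k) = (rho q \<odot> (w (k + 1) \<odot> U)) \<ominus> (rho q \<odot> (w k \<odot> V))"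
    and "q_commutator A q e U = lam \<odot> V \<Longrightarrow>
      q_commutator A q (G_image e k) (w 0 \<odot> U) = (rho q \<odot> (w (k + 1) \<odot> U)) \<ominus> (rho q \<odot> (w k \<odot> V))"
proof -
  \<comment> \<open>Regrouping with variables prevents the sums hidden in \<open>lam\<close> and
    \<open>c\<close> from being multiplied out.\<close>
  have "- (L * C * z) * D = - (L * (C * D)) * z" for L C z D :: 'k
    by (simp add: ac_simps)
  from this[of lam c "w (Suc k)" "q - inverse q"] have "- (lam * c * w (Suc k)) * (q - inverse q) = rho q * w (Suc k)"
    by (simp only: lam_factor[symmetric] rho_def power2_eq_square[of lam])
  moreover have "lam * w k * lam = - (rho q * w k)"
    by (simp add: rho_def power2_eq_square)
  ultimately show "q_commutator A q U e = lam \<odot> V \<Longrightarrow>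
      q_commutator A q (w 0 \<odot> U) (G_image e k) = (rho q \<odot> (w (k + 1) \<odot> U)) \<ominus> (rho q \<odot> (w k \<odot> V))"
    and "q_commutator A q e U = lam \<odot> V \<Longrightarrow>
      q_commutator A q (G_image e k) (w 0 \<odot> U) = (rho q \<odot> (w (k + 1) \<odot> U)) \<ominus> (rho q \<odot> (w k \<odot> V))"
    using assms
    by (simp_all only: G_image_def q_commutator_smult_add_one omega_0 smult_1 smult_smult)
       (simp_all add: a_minus_def smult_minus a_comm)
qed

text \<open>In each case the two terms are the same scalar multiple of [a, b] and of [b, a].\<close>

lemma relation_sym:
  assumes "a \<in> carrier A" "b \<in> carrier A"
  shows "commutator A (w k \<odot> a) (w l \<odot> b) \<oplus> commutator A (w k \<odot> b) (w l \<odot> a) = \<zero>"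
    and "commutator A (w k \<odot> a) (G_image b l) \<oplus> commutator A (G_image b k) (w l \<odot> a) = \<zero>"
    and "commutator A (G_image a k) (G_image b l) \<oplus> commutator A (G_image b k) (G_image a l) = \<zero>"
  using assms commutator_swap[of a b]
  by (simp_all add: G_image_def commutator_smult commutator_smult_add_one smult_smult smult_add_zero)

lemma ace_relation_holds:
  assumes c: "c \<noteq> 0" and h: "alg_hom_pair free_algebra A h"
    and gen: "\<And>g. h (free_gen g) = alt_image g" and lr: "(l, r) \<in> ace_relations q"
  shows "h l = h r"
proof -
  interpret h: alg_hom_pair free_algebra A h by (rule h)
  note rels = relation_comm[OF c] relation_q_comm(1)[OF _ _ _ X_E] relation_q_comm(2)[OF _ _ _ F_X]
    relation_q_comm(2)[OF _ _ _ E_Y] relation_q_comm(1)[OF _ _ _ Y_F] relation_sym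
  have self: "commutator A (w k \<odot> a) (w l \<odot> a) = \<zero>" "commutator A (G_image a k) (G_image a l) = \<zero>"
    if "a \<in> carrier A" for a k l
    using that by (simp_all add: G_image_def commutator_smult commutator_smult_add_one commutator_self)
  have "(l, r) \<in> ace_relations q \<Longrightarrow> h l = h r"
    unfolding ace_relations_def Let_def
    by (elim UnE UN_E insertE emptyE; unfold prod.inject; elim conjE; hypsubst)
      \<comment> \<open>\<open>w 0\<close> must stay unevaluated to match the relation
        lemmas.\<close>
      (simp_all add: gen h.hom_commutator h.hom_q_commutator self rels del: omega_0)
  from this[OF lr] show ?thesis .
qed

end

section \<open>The three concrete presentations\<close>

interpretation free: nc_algebra "free_algebra :: ('k::field, 'g list \<Rightarrow> 'k) module"
  by (rule free_algebra_nc_algebra)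

lemma ace_presentation: "presentation (ace_relations q)"
  unfolding ace_relations_def Let_def by unfold_locales auto

lemma torus_presentation: "presentation (torus_relations q)"
  unfolding torus_relations_def Let_def by unfold_locales auto

lemma onsager_presentation: "presentation (onsager_relations q)"
  unfolding onsager_relations_def Let_def by unfold_locales auto

section \<open>Vanishing of the central generators\<close>

context torus
begin

text \<open>After inserting the formulas for XY, YX and EF, the first two hypotheses kill the
  coefficients of E and F, the next two those of X^2 and Y^2, and the last evaluates the multiple of
  1.\<close>

lemma combine_Z:
  assumes "inverse q * a1 + q * a2 + a6 = 0" "q * a1 + inverse q * a2 + a7 = 0"
    and "a3 = q\<^sup>2 * a5" "a4 = inverse q ^ 2 * a5" "a8 - 2 * (q\<^sup>2 + inverse q ^ 2) * a5 = z"
  shows "(a1 \<odot> (X \<otimes> Y) \<oplus> a2 \<odot> (Y \<otimes> X) \<ominus> a3 \<odot> (X \<otimes> X) \<ominus> a4 \<odot> (Y \<otimes> Y)) \<oplus>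
      ((a5 \<odot> (E \<otimes> F) \<oplus> a7 \<odot> F) \<oplus> (a6 \<odot> E \<oplus> a8 \<odot> \<one>)) = z \<odot> \<one>"
proof -
  have collect: "((a1 * q) \<odot> F \<oplus> (a1 * inverse q) \<odot> E \<oplus> ((a2 * q) \<odot> E \<oplus> (a2 * inverse q) \<odot> F) \<oplus>
        r3 \<odot> P \<oplus> r4 \<odot> R) \<oplus> ((s3 \<odot> P \<oplus> s4 \<odot> R \<oplus> s5 \<odot> \<one> \<oplus> a7 \<odot> F) \<oplus> (a6 \<odot> E \<oplus> a8 \<odot> \<one>)) =
      ((r3 + s3) \<odot> P \<oplus> (r4 + s4) \<odot> R) \<oplus>
      ((a1 * inverse q + a2 * q + a6) \<odot> E \<oplus> (a1 * q + a2 * inverse q + a7) \<odot> F \<oplus> (s5 + a8) \<odot> \<one>)"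
    if "P \<in> carrier A" "R \<in> carrier A" for r3 r4 s3 s4 s5 P R
    using that by (simp add: smult_l_distr a_ac)
  show ?thesis
    unfolding EF unfolding XY YX
    using collect[of "X \<otimes> X" "Y \<otimes> Y" "- a3" "- a4" "a5 * q\<^sup>2" "a5 * inverse q ^ 2"
        "a5 * (- 2 * (q\<^sup>2 + inverse q ^ 2))"] assms
    by (simp add: smult_r_distr smult_smult a_minus_def smult_minus mult.commute algebra_simps)
qed

text \<open>The conventional constant term fits the closed form because \<omega> starts with 1 and
  \<open>G_zero q\<close> equals -\<open>lam\<close> c.\<close>

lemma G_image_series: "G_series q A (G_image a) = ser (fps_const lam * (fps_X * omega q)) a \<oplus>\<^bsub>PS\<^esub>
    ser (fps_const (- (lam * c)) * omega q) \<one>" if "a \<in> carrier A"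
proof
  fix n
  have "G_zero q = - (lam * c)"
    by (simp add: G_zero_def lam_factor power2_eq_square algebra_simps)
  with that show "G_series q A (G_image a) n = (ser (fps_const lam * (fps_X * omega q)) a \<oplus>\<^bsub>PS\<^esub>
      ser (fps_const (- (lam * c)) * omega q) \<one>) n"
    by (cases n) (simp_all add: G_series_def PS_add_nth G_image_def)
qed

lemma Z_value:
  assumes lam: "lam \<noteq> 0" and c: "c \<noteq> 0"
  defines "S \<equiv> S_ser q" and "T \<equiv> T_ser q"
  shows "((fps_shift 1 (S * T) \<odot>\<^bsub>PS\<^esub> (series_subst A (ser (omega q) X) S \<otimes>\<^bsub>PS\<^esub> series_subst A (ser (omega q) Y) T))
        \<oplus>\<^bsub>PS\<^esub> ((fps_X * S * T) \<odot>\<^bsub>PS\<^esub> (series_subst A (ser (omega q) Y) S \<otimes>\<^bsub>PS\<^esub> series_subst A (ser (omega q) X) T))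
        \<ominus>\<^bsub>PS\<^esub> ((fps_const (q\<^sup>2) * S * T) \<odot>\<^bsub>PS\<^esub> (series_subst A (ser (omega q) X) S \<otimes>\<^bsub>PS\<^esub> series_subst A (ser (omega q) X) T))
        \<ominus>\<^bsub>PS\<^esub> ((fps_const (inverse q ^ 2) * S * T)
             \<odot>\<^bsub>PS\<^esub> (series_subst A (ser (omega q) Y) S \<otimes>\<^bsub>PS\<^esub> series_subst A (ser (omega q) Y) T)))
        \<oplus>\<^bsub>PS\<^esub> (fps_const (inverse (lam\<^sup>2))
             \<odot>\<^bsub>PS\<^esub> (series_subst A (G_series q A (G_image E)) S \<otimes>\<^bsub>PS\<^esub> series_subst A (G_series q A (G_image F)) T)) =
      ser (fps_const (c\<^sup>2)) \<one>" (is "?Z = _")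
proof
  fix n
  define u v where "u = fps_compose (omega q) S" and "v = fps_compose (omega q) T"
  have S0: "fps_nth S 0 = 0" and T0: "fps_nth T 0 = 0" by (simp_all add: S_def T_def)
  \<comment> \<open>A1 to A8 are the scalar series in front of XY, YX, X^2, Y^2 (the latter two
    subtracted), EF, E, F and 1.\<close>
  define A1 A2 A3 A4 where "A1 = fps_shift 1 (S * T) * (u * v)" and "A2 = fps_X * S * T * (u * v)"
    and "A3 = fps_const (q\<^sup>2) * S * T * (u * v)" and "A4 = fps_const (inverse q ^ 2) * S * T * (u * v)"
  define A5 A6 A7 A8 where "A5 = S * T * (u * v)" and "A6 = - (fps_const c * S * (u * v))"
    and "A7 = - (fps_const c * T * (u * v))" and "A8 = fps_const (c\<^sup>2) * (u * v)"
  have compose: "fps_compose (fps_const r * (fps_X * omega q)) s = fps_const r * (s * fps_compose (omega q) s)"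
    "fps_compose (fps_const (- r) * omega q) s = fps_const (- r) * fps_compose (omega q) s"
    if "fps_nth s 0 = 0" for r s
    using that by (simp_all add: fps_compose_mult_distrib fps_compose_uminus)
  have GG: "series_subst A (G_series q A (G_image E)) S \<otimes>\<^bsub>PS\<^esub> series_subst A (G_series q A (G_image F)) T =
      (ser (fps_const lam * (S * u) * (fps_const lam * (T * v))) (E \<otimes> F) \<oplus>\<^bsub>PS\<^esub>
       ser (fps_const (- (lam * c)) * u * (fps_const lam * (T * v))) F) \<oplus>\<^bsub>PS\<^esub>
      (ser (fps_const lam * (S * u) * (fps_const (- (lam * c)) * v)) E \<oplus>\<^bsub>PS\<^esub>
       ser (fps_const (- (lam * c)) * u * (fps_const (- (lam * c)) * v)) \<one>)"
    by (simp add: G_image_series subst_PS_add subst_ser compose[OF S0] compose[OF T0]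
        mult_PS_add_left mult_PS_add_right mult_ser flip: u_def v_def)
  \<comment> \<open>J and L stand for \<open>lam\<close>^-2 and \<open>lam\<close>: the
    normalisation of the last summand cancels the factor \<open>lam\<close> in each of the two G
    series.\<close>
  have factor: "J * (L * a * (L * b)) = a * b" "J * (L * a * (- (L * C) * b)) = - (C * a * b)"
    "J * (- (L * C) * a * (L * b)) = - (C * a * b)" "J * (- (L * C) * a * (- (L * C) * b)) = C\<^sup>2 * (a * b)"
    if JLL: "J * (L * L) = 1" for J L C a b :: "'k fps"
  proof -
    have "J * (L * a * (L * b)) = (J * (L * L)) * (a * b)" "J * (L * a * (- (L * C) * b)) = - ((J * (L * L)) * (C * a * b))"
      "J * (- (L * C) * a * (L * b)) = - ((J * (L * L)) * (C * a * b))"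
      "J * (- (L * C) * a * (- (L * C) * b)) = (J * (L * L)) * (C\<^sup>2 * (a * b))"
      by (simp_all add: ac_simps power2_eq_square)
    then show "J * (L * a * (L * b)) = a * b" "J * (L * a * (- (L * C) * b)) = - (C * a * b)"
      "J * (- (L * C) * a * (L * b)) = - (C * a * b)" "J * (- (L * C) * a * (- (L * C) * b)) = C\<^sup>2 * (a * b)"
      by (simp_all add: JLL)
  qed
  have "inverse (lam\<^sup>2) * (lam * lam) = 1"
    using lam by (simp flip: power2_eq_square)
  then have "fps_const (inverse (lam\<^sup>2)) * (fps_const lam * fps_const lam) = 1"
    by (simp only: fps_const_mult fps_const_1_eq_1)
  note factor = factor[OF this]
  have "- (fps_const lam * fps_const c) = fps_const (- (lam * c))" by simp
  moreover have "(fps_const c)\<^sup>2 = fps_const (c\<^sup>2)" by (simp add: fps_const_power)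
  ultimately have const: "fps_const (inverse (lam\<^sup>2)) * (fps_const lam * a * (fps_const lam * b)) = a * b"
    "fps_const (inverse (lam\<^sup>2)) * (fps_const lam * a * (fps_const (- (lam * c)) * b)) = - (fps_const c * a * b)"
    "fps_const (inverse (lam\<^sup>2)) * (fps_const (- (lam * c)) * a * (fps_const lam * b)) = - (fps_const c * a * b)"
    "fps_const (inverse (lam\<^sup>2)) * (fps_const (- (lam * c)) * a * (fps_const (- (lam * c)) * b)) = fps_const (c\<^sup>2) * (a * b)"
    for a b
    using factor(1)[where a = a and b = b] factor(2-4)[where C = "fps_const c" and a = a and b = b] by (simp_all only:)
  have Z: "?Z = (ser A1 (X \<otimes> Y) \<oplus>\<^bsub>PS\<^esub> ser A2 (Y \<otimes> X) \<ominus>\<^bsub>PS\<^esub> ser A3 (X \<otimes> X) \<ominus>\<^bsub>PS\<^esub> ser A4 (Y \<otimes> Y)) \<oplus>\<^bsub>PS\<^esub>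
      ((ser A5 (E \<otimes> F) \<oplus>\<^bsub>PS\<^esub> ser A7 F) \<oplus>\<^bsub>PS\<^esub> (ser A6 E \<oplus>\<^bsub>PS\<^esub> ser A8 \<one>))"
    unfolding GG
    by (simp add: subst_ser mult_ser smult_ser smult_PS_add const flip: u_def v_def)
       (simp add: A1_def A2_def A3_def A4_def A5_def A6_def A7_def A8_def ac_simps)
  \<comment> \<open>e1 to e4 are the hypotheses of \<open>combine_Z\<close> as identities of series;
    the last of them is \<open>omega_S_T\<close>.\<close>
  have e1: "fps_const (inverse q) * A1 + fps_const q * A2 + A6 = 0"
    using arg_cong[OF shift_ST_S[OF q], of "\<lambda>s. s * (u * v)"]
    by (simp add: A1_def A2_def A6_def S_def T_def algebra_simps)
  have e2: "fps_const q * A1 + fps_const (inverse q) * A2 + A7 = 0"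
    using arg_cong[OF shift_ST_T[OF q], of "\<lambda>s. s * (u * v)"]
    by (simp add: A1_def A2_def A7_def S_def T_def algebra_simps)
  have e3: "A3 = fps_const (q\<^sup>2) * A5" "A4 = fps_const (inverse q ^ 2) * A5"
    by (simp_all add: A3_def A4_def A5_def mult.assoc)
  have e4: "A8 - fps_const (2 * (q\<^sup>2 + inverse q ^ 2)) * A5 = fps_const (c\<^sup>2)"
    using omega_S_T[OF q c] by (simp add: A8_def A5_def u_def v_def S_def T_def algebra_simps)
  have "?Z n = (fps_nth A1 n \<odot> (X \<otimes> Y) \<oplus> fps_nth A2 n \<odot> (Y \<otimes> X) \<ominus> fps_nth A3 n \<odot> (X \<otimes> X) \<ominus> fps_nth A4 n \<odot> (Y \<otimes> Y)) \<oplus>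
      ((fps_nth A5 n \<odot> (E \<otimes> F) \<oplus> fps_nth A7 n \<odot> F) \<oplus> (fps_nth A6 n \<odot> E \<oplus> fps_nth A8 n \<odot> \<one>))"
    unfolding Z by (simp add: PS_add_nth PS_minus_nth)
  also have "\<dots> = fps_nth (fps_const (c\<^sup>2)) n \<odot> \<one>"
    by (rule combine_Z)
       (use arg_cong[OF e1, of "\<lambda>s. fps_nth s n"] arg_cong[OF e2, of "\<lambda>s. fps_nth s n"]
         arg_cong[OF e3(1), of "\<lambda>s. fps_nth s n"] arg_cong[OF e3(2), of "\<lambda>s. fps_nth s n"]
         arg_cong[OF e4, of "\<lambda>s. fps_nth s n"] in \<open>simp_all only: fps_add_nth fps_sub_nth
           fps_mult_left_const_nth fps_zero_nth\<close>)
  finally show "?Z n = ser (fps_const (c\<^sup>2)) \<one> n" by simp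
qed

end

theorem theorem8p1:
  fixes q :: "'k::field_char_0"
    and \<phi> :: "((onsager_gen list \<Rightarrow> 'k) set \<times> (nat multiset \<Rightarrow> 'k) \<Rightarrow> 'k) set
               \<Rightarrow> (ace_gen list \<Rightarrow> 'k) set"
    and p :: "(onsager_gen list \<Rightarrow> 'k) set \<Rightarrow> (torus_gen list \<Rightarrow> 'k) set"
  assumes "q \<noteq> 0" and "q ^ 4 \<noteq> 1"
    and "is_tensor_iso q \<phi>"
    and "is_torus_projection q p"
  shows
    "let T = quantum_torus q; P = series_algebra T;
         x = torus_elem q TX; x' = torus_elem q TXinv;
         y = torus_elem q TY; y' = torus_elem q TYinv;
         alt = (\<lambda>a. p (gamma q \<phi> (ace_elem q a)));
         w_minus = (\<lambda>i. alt (Wneg i));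
         w_plus = (\<lambda>i. alt (Wpos i));
         g = G_series q T (\<lambda>k. alt (Gpl k));
         g_tilde = G_series q T (\<lambda>k. alt (Gtl k))
     in
       w_minus = omega q \<odot>\<^bsub>P\<^esub> series_const T (x \<oplus>\<^bsub>T\<^esub> x') \<and>
       w_plus = omega q \<odot>\<^bsub>P\<^esub> series_const T (y \<oplus>\<^bsub>T\<^esub> y') \<and>
       g = (fps_const (q\<^sup>2 - inverse q ^ 2) * omega q) \<odot>\<^bsub>P\<^esub>
             ((fps_X \<odot>\<^bsub>P\<^esub> series_const T ((q \<odot>\<^bsub>T\<^esub> (x' \<otimes>\<^bsub>T\<^esub> y)) \<oplus>\<^bsub>T\<^esub> (q \<odot>\<^bsub>T\<^esub> (x \<otimes>\<^bsub>T\<^esub> y'))))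
              \<ominus>\<^bsub>P\<^esub> (fps_const q \<odot>\<^bsub>P\<^esub> \<one>\<^bsub>P\<^esub>) \<ominus>\<^bsub>P\<^esub> (fps_const (inverse q) \<odot>\<^bsub>P\<^esub> \<one>\<^bsub>P\<^esub>)) \<and>
       g_tilde = (fps_const (q\<^sup>2 - inverse q ^ 2) * omega q) \<odot>\<^bsub>P\<^esub>
             ((fps_X \<odot>\<^bsub>P\<^esub> series_const T ((inverse q \<odot>\<^bsub>T\<^esub> (x \<otimes>\<^bsub>T\<^esub> y)) \<oplus>\<^bsub>T\<^esub>
                                       (inverse q \<odot>\<^bsub>T\<^esub> (x' \<otimes>\<^bsub>T\<^esub> y'))))
              \<ominus>\<^bsub>P\<^esub> (fps_const q \<odot>\<^bsub>P\<^esub> \<one>\<^bsub>P\<^esub>) \<ominus>\<^bsub>P\<^esub> (fps_const (inverse q) \<odot>\<^bsub>P\<^esub> \<one>\<^bsub>P\<^esub>))"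
proof -
  note [simp] = assms(1)
  note c = q_plus_inverse_nz(1)[OF assms(1,2)] and lam = q_plus_inverse_nz(2)[OF assms(1,2)]
  define A where "A = quantum_torus q"
  define B where "B = alt_central_ext q"
  define O' where "O' = q_Onsager q"
  define Zs where "Zs = (poly_algebra {1..} :: ('k, nat multiset \<Rightarrow> 'k) module)"
  interpret pt: presentation "torus_relations q" by (rule torus_presentation)
  interpret pa: presentation "ace_relations q" by (rule ace_presentation)
  interpret po: presentation "onsager_relations q" by (rule onsager_presentation)
  have A: "nc_algebra A" and B: "nc_algebra B" and O: "nc_algebra O'" and Z: "nc_algebra Zs"
    unfolding A_def B_def O'_def Zs_def quantum_torus_def alt_central_ext_def q_Onsager_def
    by (rule pt.presented_nc_algebra pa.presented_nc_algebra po.presented_nc_algebra poly_algebra_nc_algebra)+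
  define e where "e = torus_elem q"
  have e_closed: "e g \<in> carrier A" for g
    by (simp add: e_def A_def torus_elem_def quantum_torus_def)
  have rel: "e TX \<otimes>\<^bsub>A\<^esub> e TXinv = \<one>\<^bsub>A\<^esub>" "e TXinv \<otimes>\<^bsub>A\<^esub> e TX = \<one>\<^bsub>A\<^esub>"
    "e TY \<otimes>\<^bsub>A\<^esub> e TYinv = \<one>\<^bsub>A\<^esub>" "e TYinv \<otimes>\<^bsub>A\<^esub> e TY = \<one>\<^bsub>A\<^esub>"
    "e TX \<otimes>\<^bsub>A\<^esub> e TY = q\<^sup>2 \<odot>\<^bsub>A\<^esub> (e TY \<otimes>\<^bsub>A\<^esub> e TX)"
  proof -
    have "(l, r) \<in> torus_relations q \<Longrightarrow>
        rel_class free_algebra (torus_relations q) l = rel_class free_algebra (torus_relations q) r" for l r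
      by (rule pt.rel_class_rel)
    \<comment> \<open>The five relations are listed explicitly so that each can be extracted by its
      position in the set.\<close>
    then have "rel_class free_algebra (torus_relations q) l = rel_class free_algebra (torus_relations q) r"
      if "(l, r) \<in> {(free_gen TX \<otimes>\<^bsub>free_algebra\<^esub> free_gen TXinv, \<one>\<^bsub>free_algebra\<^esub>),
        (free_gen TXinv \<otimes>\<^bsub>free_algebra\<^esub> free_gen TX, \<one>\<^bsub>free_algebra\<^esub>),
        (free_gen TY \<otimes>\<^bsub>free_algebra\<^esub> free_gen TYinv, \<one>\<^bsub>free_algebra\<^esub>),
        (free_gen TYinv \<otimes>\<^bsub>free_algebra\<^esub> free_gen TY, \<one>\<^bsub>free_algebra\<^esub>),
        (free_gen TX \<otimes>\<^bsub>free_algebra\<^esub> free_gen TY,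
          q\<^sup>2 \<odot>\<^bsub>free_algebra\<^esub> (free_gen TY \<otimes>\<^bsub>free_algebra\<^esub> free_gen TX))}" for l r
      using that unfolding torus_relations_def Let_def by blast
    note this[OF insertI1] this[OF insertI2[OF insertI1]] this[OF insertI2[OF insertI2[OF insertI1]]]
      this[OF insertI2[OF insertI2[OF insertI2[OF insertI1]]]]
      this[OF insertI2[OF insertI2[OF insertI2[OF insertI2[OF insertI1]]]]]
    then show "e TX \<otimes>\<^bsub>A\<^esub> e TXinv = \<one>\<^bsub>A\<^esub>" "e TXinv \<otimes>\<^bsub>A\<^esub> e TX = \<one>\<^bsub>A\<^esub>"
      "e TY \<otimes>\<^bsub>A\<^esub> e TYinv = \<one>\<^bsub>A\<^esub>" "e TYinv \<otimes>\<^bsub>A\<^esub> e TY = \<one>\<^bsub>A\<^esub>"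
      "e TX \<otimes>\<^bsub>A\<^esub> e TY = q\<^sup>2 \<odot>\<^bsub>A\<^esub> (e TY \<otimes>\<^bsub>A\<^esub> e TX)"
      by (simp_all add: A_def e_def torus_elem_def quantum_torus_def presented_algebra_def presented_gen_def)
  qed
  interpret torus A q "e TX" "e TXinv" "e TY" "e TYinv"
    using A by (intro torus.intro torus_axioms.intro) (simp_all add: e_closed rel)
  have kills: "h l = h r" if "alg_hom_pair free_algebra A h" "\<And>g. h (free_gen g) = alt_image g"
    "(l, r) \<in> ace_relations q" for h l r
    using that by (rule ace_relation_holds[OF c])
  obtain \<theta> where \<theta>: "\<theta> \<in> alg_hom B A" and \<theta>_gen: "\<And>g. \<theta> (ace_elem q g) = alt_image g"
    unfolding B_def alt_central_ext_def ace_elem_def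
    by (rule pa.presented_hom_exists[where b = alt_image, OF A alt_image_closed kills]) auto
  interpret \<theta>: alg_hom_pair B A \<theta> using B A \<theta> by (rule alg_hom_pairI)
  have ace_closed: "ace_elem q g \<in> carrier B" for g
    by (simp add: B_def alt_central_ext_def ace_elem_def)
  have seq_closed: "(\<lambda>i. ace_elem q (f i)) \<in> carrier \<theta>.A.PS" for f
    by (simp add: series_algebra_def ace_closed)
  have G_closed: "G_series q B (\<lambda>i. ace_elem q (f i)) \<in> carrier \<theta>.A.PS" for f
    by (auto simp: series_algebra_def G_series_def ace_closed split: nat.split)
  have \<theta>_seq: "\<theta> \<circ> (\<lambda>i. ace_elem q (Wneg i)) = ser (omega q) X" "\<theta> \<circ> (\<lambda>i. ace_elem q (Wpos i)) = ser (omega q) Y"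
    "\<theta> \<circ> (\<lambda>i. ace_elem q (Gpl i)) = G_image E" "\<theta> \<circ> (\<lambda>i. ace_elem q (Gtl i)) = G_image F"
    by (simp_all add: fun_eq_iff \<theta>_gen)
  \<comment> \<open>\<open>Z_value\<close> is read backwards: the constant series is expanded to the
    defining expression, and \<theta> is pushed inward to meet it.\<close>
  have "\<theta> \<circ> Z_series q = ser (fps_const (c\<^sup>2)) \<one>\<^bsub>A\<^esub>"
    unfolding Z_value[OF lam c, symmetric] Z_series_def Let_def B_def[symmetric]
    by (simp add: \<theta>.hom_PS_add \<theta>.hom_PS_minus \<theta>.hom_PS_mult \<theta>.hom_PS_smult \<theta>.hom_series_subst
        \<theta>.hom_G_series \<theta>_seq seq_closed G_closed del: o_apply)
  then have \<theta>_Z: "\<theta> (Z_series q i) = (if i = 0 then c\<^sup>2 else 0) \<odot>\<^bsub>A\<^esub> \<one>\<^bsub>A\<^esub>" for i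
    by (simp add: fun_eq_iff)
  interpret tensor O' Zs using O Z by (rule tensor.intro)
  have \<phi>: "\<phi> \<in> alg_hom (tensor_algebra O' Zs) B" "bij_betw \<phi> (carrier (tensor_algebra O' Zs)) (carrier B)"
    and \<phi>_W: "\<phi> (pure (onsager_elem q Ons0) \<one>\<^bsub>Zs\<^esub>) = ace_elem q (Wneg 0)"
      "\<phi> (pure (onsager_elem q Ons1) \<one>\<^bsub>Zs\<^esub>) = ace_elem q (Wpos 0)"
    and \<phi>_Z: "\<And>i. i \<ge> 1 \<Longrightarrow> \<phi> (pure \<one>\<^bsub>O'\<^esub> (poly_var i)) = Z_elem q i"
    using assms(3)
    by (simp_all add: is_tensor_iso_def alg_iso_def onsager_tensor_poly_def O'_def Zs_def B_def z_poly_def)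
  have p: "p \<in> alg_hom O' A" "p (onsager_elem q Ons0) = X" "p (onsager_elem q Ons1) = Y"
    using assms(4)[unfolded is_torus_projection_def, folded A_def O'_def e_def]
    by (simp_all add: X_def Y_def)
  have h: "\<theta> \<circ> \<phi> \<in> alg_hom (tensor_algebra O' Zs) A"
    by (rule alg_hom_comp[OF \<phi>(1) \<theta>])
  \<comment> \<open>Both sides are homomorphisms on the \<open>q\<close>-Onsager algebra sending its
    two generators to \<open>X\<close> and \<open>Y\<close>.\<close>
  have left: "(\<theta> \<circ> \<phi>) (pure a \<one>\<^bsub>Zs\<^esub>) = p a" if a: "a \<in> carrier O'" for a
  proof -
    have gens: "(\<theta> \<circ> \<phi> \<circ> (\<lambda>a. pure a \<one>\<^bsub>Zs\<^esub>)) (onsager_elem q g) = p (onsager_elem q g)" for g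
      by (cases g) (simp_all add: \<phi>_W \<theta>_gen p)
    show ?thesis
      using po.presented_hom_unique[OF A, of "\<theta> \<circ> \<phi> \<circ> (\<lambda>a. pure a \<one>\<^bsub>Zs\<^esub>)" p a]
        alg_hom_comp[OF pure_left_hom h] p(1) gens a
      by (simp add: O'_def q_Onsager_def onsager_elem_def)
  qed
  have "Z_series q \<in> carrier \<theta>.A.PS"
    unfolding Z_series_def Let_def B_def[symmetric] by (simp add: seq_closed G_closed)
  then have "Z_series q i \<in> carrier B" for i by (rule \<theta>.A.PS_nth_closed)
  then have right: "(\<theta> \<circ> \<phi>) (pure \<one>\<^bsub>O'\<^esub> (poly_var i)) = \<zero>\<^bsub>A\<^esub>" if "i \<in> {1..}" for i
    using that by (simp add: \<phi>_Z Z_elem_def \<theta>_Z flip: B_def)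
  have alt: "p (gamma q \<phi> (ace_elem q g)) = alt_image g" for g
  proof -
    \<comment> \<open>This preimage is the element on which \<open>gamma\<close> sets the variables
      to zero, so evaluating \<theta> at \<phi>(t) in two ways gives the claim.\<close>
    define t where "t = inv_into (carrier (tensor_algebra O' Zs)) \<phi> (ace_elem q g)"
    have t: "t \<in> carrier (tensor_algebra O' Zs)" "\<phi> t = ace_elem q g"
      using \<phi>(2) ace_closed[of g] unfolding t_def bij_betw_def
      by (metis inv_into_into, metis f_inv_into_f)
    have "(\<theta> \<circ> \<phi>) t = p (set_vars_zero O' t)"
      using h left right t(1) unfolding Zs_def by (intro tensor_hom_set_vars_zero[OF O A _ p(1)])
    then have "alt_image g = p (set_vars_zero O' t)" by (simp add: t(2) \<theta>_gen)
    also have "set_vars_zero O' t = gamma q \<phi> (ace_elem q g)"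
      by (simp add: gamma_def onsager_tensor_poly_def z_poly_def t_def O'_def Zs_def)
    finally show ?thesis by (rule sym)
  qed
  have G: "G_series q A (G_image a) = (fps_const lam * omega q) \<odot>\<^bsub>PS\<^esub>
      ((fps_X \<odot>\<^bsub>PS\<^esub> series_const A a) \<ominus>\<^bsub>PS\<^esub> (fps_const q \<odot>\<^bsub>PS\<^esub> \<one>\<^bsub>PS\<^esub>) \<ominus>\<^bsub>PS\<^esub> (fps_const (inverse q) \<odot>\<^bsub>PS\<^esub> \<one>\<^bsub>PS\<^esub>))"
    if a: "a \<in> carrier A" for a
  proof -
    \<comment> \<open>Merging the two subtracted constants into -c gives the two-term shape of
      \<open>G_image_series\<close>.\<close>
    have "(fps_X \<odot>\<^bsub>PS\<^esub> series_const A a) \<ominus>\<^bsub>PS\<^esub> (fps_const q \<odot>\<^bsub>PS\<^esub> \<one>\<^bsub>PS\<^esub>) \<ominus>\<^bsub>PS\<^esub> (fps_const (inverse q) \<odot>\<^bsub>PS\<^esub> \<one>\<^bsub>PS\<^esub>) =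
        ser fps_X a \<oplus>\<^bsub>PS\<^esub> ser (- fps_const c) \<one>\<^bsub>A\<^esub>"
      using a by (simp add: fun_eq_iff PS_one series_const_eq_ser smult_ser PS_minus_nth PS_add_nth)
        (simp add: a_minus_def smult_minus a_assoc flip: smult_l_distr)
    moreover have "- (c * lam) = (- q - inverse q) * lam"
      by (simp add: left_diff_distrib distrib_right)
    ultimately show ?thesis
      using a by (simp add: G_image_series smult_PS_add smult_ser mult_ac)
  qed
  show ?thesis
    unfolding Let_def A_def[symmetric] e_def[symmetric] alt
    using G[OF XYEF_closed(3)] G[OF XYEF_closed(4)]
    by (simp add: series_const_eq_ser smult_ser fun_eq_iff flip: X_def Y_def E_def F_def)
qed

end
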